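(* Let $M$ be an $EMV$-algebra. (i) If $I$ is a maximal ideal of $M$, then $M/I$ can be embedded in a unique way into the $MV$-algebra of the real interval $[0,1]$ such that the mapping $s_I: x\mapsto x/I$, $x\in M$ (where $x/I$ is identified with its image in $[0,1]$), is a state-morphism. (ii) If $s$ is a state-morphism on $M$, then $\mathrm{Ker}(s)=\{x\in M: s(x)=0\}$ is a maximal ideal of $M$. In addition, there is a unique maximal ideal $I$ of $M$ such that $s=s_I$. (iii) If $s_1,s_2$ are state-morphisms on $M$ with $\mathrm{Ker}(s_1)=\mathrm{Ker}(s_2)$, then $s_1=s_2$.
   Context: An algebra $(M;\vee,\wedge,\oplus,0)$ of type $(2,2,2,0)$ is an $EMV$-algebra if: (1) $(M;\vee,\wedge,0)$ is a distributive lattice with least element $0$; (2) $(M;\oplus,0)$ is a commutative ordered monoid with neutral element $0$; (3) writing $\mathcal I(M)=\{a\in M: a\oplus a=a\}$, for all $a\le b$ in $\mathcal I(M)$ and all $x\in[a,b]$ the element $\lambda_{a,b}(x)=\min\{z\in[a,b]: x\oplus z=b\}$ exists in $M$, and $([a,b];\oplus,\lambda_{a,b},a,b)$ is an $MV$-algebra; (4) each $x\in M$ lies below some $a\in\mathcal I(M)$. We write $\lambda_b:=\lambda_{0,b}$. Every $MV$-algebra is regarded as an $EMV$-algebra with its lattice operations, $\oplus$ and $0$; an $EMV$-algebra with a top element $1$ is an $MV$-algebra $(M;\oplus,\lambda_1,0,1)$. An $EMV$-homomorphism $f:M_1\to M_2$ between $EMV$-algebras is a map preserving $\vee,\wedge,\oplus,0$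 such that $f(\lambda_b(x))=\lambda_{f(b)}(f(x))$ for all $b\in\mathcal I(M_1)$, $x\in[0,b]$. An embedding is an injective $EMV$-homomorphism. An ideal of $M$ is a non-empty down-closed subset closed under $\oplus$. It is maximal if it is proper and for every $x\in M\setminus I$ the ideal generated by $I\cup\{x\}$ is $M$. For an ideal $I$, $\theta_I$ is the congruence on $M$ given by $(x,y)\in\theta_I$ iff there is $b\in\mathcal I(M)$ with $x,y\le b$ and $\lambda_b(\lambda_b(x)\oplus y),\lambda_b(\lambda_b(y)\oplus x)\in I$; $M/I$ is the quotient $EMV$-algebra $M/\theta_I$ with the induced operations, and $x/I$ is the class of $x$. The $MV$-algebra of the real interval $[0,1]$ has $x\oplus y=\min\{x+y,1\}$ and $x'=1-x$. A state-morphism on $M$ is an $EMV$-homomorphism $s:M\to[0,1]$ such that $s(x)=1$ for some $x\in M$. *)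

theory Defs
  imports Complex_Main "HOL-Algebra.Group"
begin

record 'a emv = "'a partial_object" +
  emv_join :: "'a \<Rightarrow> 'a \<Rightarrow> 'a" (infixl "\<curlyvee>\<index>" 65)
  emv_meet :: "'a \<Rightarrow> 'a \<Rightarrow> 'a" (infixl "\<curlywedge>\<index>" 70)
  emv_plus :: "'a \<Rightarrow> 'a \<Rightarrow> 'a" (infixl "\<boxplus>\<index>" 65)
  emv_zero :: 'a ("\<zero>\<index>")

definition emv_le :: "('a, 'm) emv_scheme \<Rightarrow> 'a \<Rightarrow> 'a \<Rightarrow> bool" (infix "\<preceq>\<index>" 50) where
  "x \<preceq>\<^bsub>M\<^esub> y \<longleftrightarrow> x \<in> carrier M \<and> y \<in> carrier M \<and> x \<curlywedge>\<^bsub>M\<^esub> y = x"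

definition emv_interval :: "('a, 'm) emv_scheme \<Rightarrow> 'a \<Rightarrow> 'a \<Rightarrow> 'a set" where
  "emv_interval M a b = {x \<in> carrier M. a \<preceq>\<^bsub>M\<^esub> x \<and> x \<preceq>\<^bsub>M\<^esub> b}"

definition emv_idem :: "('a, 'm) emv_scheme \<Rightarrow> 'a set" where
  "emv_idem M = {a \<in> carrier M. a \<boxplus>\<^bsub>M\<^esub> a = a}"

definition emv_is_min :: "('a, 'm) emv_scheme \<Rightarrow> 'a set \<Rightarrow> 'a \<Rightarrow> bool" where
  "emv_is_min M S z \<longleftrightarrow> z \<in> S \<and> (\<forall>w\<in>S. z \<preceq>\<^bsub>M\<^esub> w)"

text \<open>The set whose minimum is \<open>\<lambda>\<^sub>a\<^sub>,\<^sub>b(x)\<close>; the value of \<open>emv_lam\<close> is meaningful only if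
  that minimum exists.\<close>

definition emv_complements :: "('a, 'm) emv_scheme \<Rightarrow> 'a \<Rightarrow> 'a \<Rightarrow> 'a \<Rightarrow> 'a set" where
  "emv_complements M a b x = {z \<in> emv_interval M a b. x \<boxplus>\<^bsub>M\<^esub> z = b}"

definition emv_lam :: "('a, 'm) emv_scheme \<Rightarrow> 'a \<Rightarrow> 'a \<Rightarrow> 'a \<Rightarrow> 'a" where
  "emv_lam M a b x = (THE z. emv_is_min M (emv_complements M a b x) z)"

abbreviation emv_lam0 :: "('a, 'm) emv_scheme \<Rightarrow> 'a \<Rightarrow> 'a \<Rightarrow> 'a" where
  "emv_lam0 M b x \<equiv> emv_lam M \<zero>\<^bsub>M\<^esub> b x"

locale mv_algebra =
  fixes A :: "'a set" and plus :: "'a \<Rightarrow> 'a \<Rightarrow> 'a" and neg :: "'a \<Rightarrow> 'a" and zero one :: 'a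
  assumes plus_comm_monoid: "comm_monoid \<lparr>carrier = A, mult = plus, one = zero\<rparr>"
    and neg_closed: "x \<in> A \<Longrightarrow> neg x \<in> A"
    and one_closed: "one \<in> A"
    and neg_zero: "neg zero = one"
    and neg_neg: "x \<in> A \<Longrightarrow> neg (neg x) = x"
    and plus_one: "x \<in> A \<Longrightarrow> plus x one = one"
    and lukasiewicz: "\<lbrakk>x \<in> A; y \<in> A\<rbrakk> \<Longrightarrow>
      plus x (neg (plus x (neg y))) = plus y (neg (plus y (neg x)))"

locale emv_algebra =
  fixes M :: "('a, 'm) emv_scheme" (structure)
  assumes join_closed: "\<lbrakk>x \<in> carrier M; y \<in> carrier M\<rbrakk> \<Longrightarrow> x \<curlyvee> y \<in> carrier M"
    and meet_closed: "\<lbrakk>x \<in> carrier M; y \<in> carrier M\<rbrakk> \<Longrightarrow> x \<curlywedge> y \<in> carrier M"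
    and join_comm: "\<lbrakk>x \<in> carrier M; y \<in> carrier M\<rbrakk> \<Longrightarrow> x \<curlyvee> y = y \<curlyvee> x"
    and meet_comm: "\<lbrakk>x \<in> carrier M; y \<in> carrier M\<rbrakk> \<Longrightarrow> x \<curlywedge> y = y \<curlywedge> x"
    and join_assoc: "\<lbrakk>x \<in> carrier M; y \<in> carrier M; z \<in> carrier M\<rbrakk> \<Longrightarrow>
      (x \<curlyvee> y) \<curlyvee> z = x \<curlyvee> (y \<curlyvee> z)"
    and meet_assoc: "\<lbrakk>x \<in> carrier M; y \<in> carrier M; z \<in> carrier M\<rbrakk> \<Longrightarrow>
      (x \<curlywedge> y) \<curlywedge> z = x \<curlywedge> (y \<curlywedge> z)"
    and join_absorb: "\<lbrakk>x \<in> carrier M; y \<in> carrier M\<rbrakk> \<Longrightarrow> x \<curlyvee> (x \<curlywedge> y) = x"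
    and meet_absorb: "\<lbrakk>x \<in> carrier M; y \<in> carrier M\<rbrakk> \<Longrightarrow> x \<curlywedge> (x \<curlyvee> y) = x"
    and meet_distrib: "\<lbrakk>x \<in> carrier M; y \<in> carrier M; z \<in> carrier M\<rbrakk> \<Longrightarrow>
      x \<curlywedge> (y \<curlyvee> z) = (x \<curlywedge> y) \<curlyvee> (x \<curlywedge> z)"
    and zero_least: "x \<in> carrier M \<Longrightarrow> \<zero> \<preceq> x"
    and plus_comm_monoid:
      "comm_monoid \<lparr>carrier = carrier M, mult = (\<boxplus>), one = \<zero>\<rparr>"
    and plus_mono: "\<lbrakk>x \<preceq> y; z \<in> carrier M\<rbrakk> \<Longrightarrow> x \<boxplus> z \<preceq> y \<boxplus> z"
    and lam_exists:
      "\<lbrakk>a \<in> emv_idem M; b \<in> emv_idem M; a \<preceq> b; x \<in> emv_interval M a b\<rbrakk> \<Longrightarrow>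
        \<exists>z. emv_is_min M (emv_complements M a b x) z"
    and interval_mv:
      "\<lbrakk>a \<in> emv_idem M; b \<in> emv_idem M; a \<preceq> b\<rbrakk> \<Longrightarrow>
        mv_algebra (emv_interval M a b) (\<boxplus>) (emv_lam M a b) a b"
    and below_idem: "x \<in> carrier M \<Longrightarrow> \<exists>a\<in>emv_idem M. x \<preceq> a"

definition emv_hom ::
    "('a, 'm) emv_scheme \<Rightarrow> ('b, 'n) emv_scheme \<Rightarrow> ('a \<Rightarrow> 'b) \<Rightarrow> bool" where
  "emv_hom M N f \<longleftrightarrow>
     emv_algebra M \<and> emv_algebra N \<and> f \<in> carrier M \<rightarrow> carrier N \<and>
     (\<forall>x\<in>carrier M. \<forall>y\<in>carrier M. f (x \<curlyvee>\<^bsub>M\<^esub> y) = f x \<curlyvee>\<^bsub>N\<^esub> f y) \<and>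
     (\<forall>x\<in>carrier M. \<forall>y\<in>carrier M. f (x \<curlywedge>\<^bsub>M\<^esub> y) = f x \<curlywedge>\<^bsub>N\<^esub> f y) \<and>
     (\<forall>x\<in>carrier M. \<forall>y\<in>carrier M. f (x \<boxplus>\<^bsub>M\<^esub> y) = f x \<boxplus>\<^bsub>N\<^esub> f y) \<and>
     f \<zero>\<^bsub>M\<^esub> = \<zero>\<^bsub>N\<^esub> \<and>
     (\<forall>b\<in>emv_idem M. \<forall>x\<in>emv_interval M \<zero>\<^bsub>M\<^esub> b.
        f (emv_lam0 M b x) = emv_lam0 N (f b) (f x))"

definition emv_embedding ::
    "('a, 'm) emv_scheme \<Rightarrow> ('b, 'n) emv_scheme \<Rightarrow> ('a \<Rightarrow> 'b) \<Rightarrow> bool" where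
  "emv_embedding M N f \<longleftrightarrow> emv_hom M N f \<and> inj_on f (carrier M)"

definition emv_ideal :: "('a, 'm) emv_scheme \<Rightarrow> 'a set \<Rightarrow> bool" where
  "emv_ideal M I \<longleftrightarrow>
     I \<subseteq> carrier M \<and> I \<noteq> {} \<and>
     (\<forall>x y. y \<in> I \<and> x \<preceq>\<^bsub>M\<^esub> y \<longrightarrow> x \<in> I) \<and>
     (\<forall>x\<in>I. \<forall>y\<in>I. x \<boxplus>\<^bsub>M\<^esub> y \<in> I)"

definition emv_maximal_ideal :: "('a, 'm) emv_scheme \<Rightarrow> 'a set \<Rightarrow> bool" where
  "emv_maximal_ideal M I \<longleftrightarrow>
     emv_ideal M I \<and> I \<noteq> carrier M \<and>
     (\<forall>x \<in> carrier M - I. emv_ideal M hull (insert x I) = carrier M)"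

definition emv_theta :: "('a, 'm) emv_scheme \<Rightarrow> 'a set \<Rightarrow> ('a \<times> 'a) set" where
  "emv_theta M I = {(x, y). x \<in> carrier M \<and> y \<in> carrier M \<and>
     (\<exists>b\<in>emv_idem M. x \<preceq>\<^bsub>M\<^esub> b \<and> y \<preceq>\<^bsub>M\<^esub> b \<and>
        emv_lam0 M b (emv_lam0 M b x \<boxplus>\<^bsub>M\<^esub> y) \<in> I \<and>
        emv_lam0 M b (emv_lam0 M b y \<boxplus>\<^bsub>M\<^esub> x) \<in> I)}"

abbreviation emv_class :: "('a, 'm) emv_scheme \<Rightarrow> 'a set \<Rightarrow> 'a \<Rightarrow> 'a set" where
  "emv_class M I x \<equiv> emv_theta M I `` {x}"

text \<open>The induced operations are written as unions over all representatives; since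
  \<open>emv_theta M I\<close> is a congruence, each union is a single class.\<close>

definition emv_quot :: "('a, 'm) emv_scheme \<Rightarrow> 'a set \<Rightarrow> 'a set emv" where
  "emv_quot M I =
     \<lparr>carrier = carrier M // emv_theta M I,
      emv_join = (\<lambda>X Y. \<Union>x\<in>X. \<Union>y\<in>Y. emv_class M I (x \<curlyvee>\<^bsub>M\<^esub> y)),
      emv_meet = (\<lambda>X Y. \<Union>x\<in>X. \<Union>y\<in>Y. emv_class M I (x \<curlywedge>\<^bsub>M\<^esub> y)),
      emv_plus = (\<lambda>X Y. \<Union>x\<in>X. \<Union>y\<in>Y. emv_class M I (x \<boxplus>\<^bsub>M\<^esub> y)),
      emv_zero = emv_class M I \<zero>\<^bsub>M\<^esub>\<rparr>"

definition unit_emv :: "real emv" where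
  "unit_emv =
     \<lparr>carrier = {0..1}, emv_join = max, emv_meet = min,
      emv_plus = (\<lambda>x y. min (x + y) 1), emv_zero = 0\<rparr>"

definition state_morphism :: "('a, 'm) emv_scheme \<Rightarrow> ('a \<Rightarrow> real) \<Rightarrow> bool" where
  "state_morphism M s \<longleftrightarrow> emv_hom M unit_emv s \<and> (\<exists>x\<in>carrier M. s x = 1)"

definition state_ker :: "('a, 'm) emv_scheme \<Rightarrow> ('a \<Rightarrow> real) \<Rightarrow> 'a set" where
  "state_ker M s = {x \<in> carrier M. s x = 0}"

text \<open>Extensionality removes the arbitrary values outside the carrier of the quotient, so that
  uniqueness of \<open>f\<close> can be stated with \<open>\<exists>!\<close>.\<close>

definition quot_embedding :: "('a, 'm) emv_scheme \<Rightarrow> 'a set \<Rightarrow> ('a set \<Rightarrow> real) \<Rightarrow> bool" where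
  "quot_embedding M I f \<longleftrightarrow>
     f \<in> extensional (carrier (emv_quot M I)) \<and>
     emv_embedding (emv_quot M I) unit_emv f \<and>
     state_morphism M (\<lambda>x. f (emv_class M I x))"

text \<open>The map \<open>s\<^sub>I\<close>, i.e.\ \<open>x \<mapsto> x/I\<close> followed by the identification of \<open>M/I\<close> with a subalgebra of
  the unit interval; it is meaningful only for those \<open>I\<close> (such as maximal ideals) for which
  the embedding exists and is unique.\<close>

definition ideal_state :: "('a, 'm) emv_scheme \<Rightarrow> 'a set \<Rightarrow> 'a \<Rightarrow> real" where
  "ideal_state M I x = (THE f. quot_embedding M I f) (emv_class M I x)"

text \<open>The structure \<open>unit_emv\<close> is the MV-algebra of the unit interval with negation
  \<open>1 - x\<close>.\<close>

lemma unit_mv_algebra: "mv_algebra {0..1} (\<lambda>x y. min (x + y) 1) (\<lambda>x. 1 - x) 0 (1::real)"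
proof (intro mv_algebra.intro)
  show "comm_monoid \<lparr>carrier = {0..1}, mult = \<lambda>x y. min (x + y) 1, one = (0::real)\<rparr>"
    by (intro comm_monoidI) (auto simp: min_def)
qed (auto simp: min_def)

lemma unit_le: "x \<preceq>\<^bsub>unit_emv\<^esub> y \<longleftrightarrow> 0 \<le> x \<and> x \<le> y \<and> y \<le> 1"
  by (auto simp: emv_le_def unit_emv_def min_def)

lemma unit_is_min:
  assumes "0 \<le> x" "x \<le> 1"
  shows "emv_is_min unit_emv (emv_complements unit_emv 0 1 x) (1 - x)"
  using assms
  by (auto simp: emv_is_min_def emv_complements_def emv_interval_def unit_le)
     (auto simp: unit_emv_def min_def split: if_splits)

lemma unit_lam:
  assumes "0 \<le> x" "x \<le> 1"
  shows "emv_lam unit_emv 0 1 x = 1 - x"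
  unfolding emv_lam_def
proof (rule the_equality)
  show min: "emv_is_min unit_emv (emv_complements unit_emv 0 1 x) (1 - x)"
    by (rule unit_is_min[OF assms])
  fix z assume "emv_is_min unit_emv (emv_complements unit_emv 0 1 x) z"
  with min show "z = 1 - x"
    by (fastforce simp: emv_is_min_def unit_le)
qed

lemma unit_idem: "emv_idem unit_emv = {0, 1}"
  by (auto simp: emv_idem_def unit_emv_def min_def)

lemma unit_lam_point:
  assumes "c = 0 \<or> c = 1"
  shows "emv_is_min unit_emv (emv_complements unit_emv c c c) c" "emv_lam unit_emv c c c = c"
proof -
  have eq: "emv_complements unit_emv c c c = {c}"
    using assms
    by (auto simp: emv_complements_def emv_interval_def unit_le) (auto simp: unit_emv_def)
  show 1: "emv_is_min unit_emv (emv_complements unit_emv c c c) c"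
    using assms by (auto simp: eq emv_is_min_def unit_le)
  show "emv_lam unit_emv c c c = c"
    unfolding emv_lam_def
    by (rule the_equality[where P = "emv_is_min unit_emv (emv_complements unit_emv c c c)", OF 1])
       (simp add: eq emv_is_min_def)
qed

lemma unit_interval:
  "emv_interval unit_emv 0 1 = {0..1}" "emv_interval unit_emv 0 0 = {0}"
  "emv_interval unit_emv 1 1 = {1}"
  by (auto simp: emv_interval_def unit_le) (auto simp: unit_emv_def)

lemma mv_algebra_cong:
  assumes "mv_algebra A p n z e" "\<And>x. x \<in> A \<Longrightarrow> n' x = n x"
  shows "mv_algebra A p n' z e"
proof -
  interpret mv_algebra A p n z e by fact
  interpret comm_monoid "\<lparr>carrier = A, mult = p, one = z\<rparr>" by (rule plus_comm_monoid)
  have "p x y \<in> A" if "x \<in> A" "y \<in> A" for x y using m_closed that by simp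
  moreover have "z \<in> A" using monoid.one_closed[OF monoid_axioms] by simp
  ultimately show ?thesis
    using assms(2) plus_comm_monoid neg_closed mv_algebra.one_closed[OF assms(1)]
      neg_zero neg_neg plus_one lukasiewicz
    by (intro mv_algebra.intro) simp_all
qed

lemma unit_emv_algebra: "emv_algebra unit_emv"
proof (intro emv_algebra.intro)
  show "comm_monoid \<lparr>carrier = carrier unit_emv, mult = (\<boxplus>\<^bsub>unit_emv\<^esub>),
      one = \<zero>\<^bsub>unit_emv\<^esub>\<rparr>"
    using mv_algebra.plus_comm_monoid[OF unit_mv_algebra] by (simp add: unit_emv_def)
next
  fix a b assume ab: "a \<in> emv_idem unit_emv" "b \<in> emv_idem unit_emv" "a \<preceq>\<^bsub>unit_emv\<^esub> b"
  then consider "a = 0" "b = 1" | "a = b" "a = 0 \<or> a = 1"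
    by (auto simp: unit_idem unit_le)
  note cases = this
  show "mv_algebra (emv_interval unit_emv a b) (\<boxplus>\<^bsub>unit_emv\<^esub>) (emv_lam unit_emv a b) a b"
    using cases
  proof cases
    case 1
    have "mv_algebra {0..1} (\<lambda>x y. min (x + y) 1) (emv_lam unit_emv 0 1) 0 1"
      by (rule mv_algebra_cong[OF unit_mv_algebra]) (simp add: unit_lam)
    then show ?thesis using 1 by (simp add: unit_interval) (simp add: unit_emv_def)
  next
    case 2
    have "mv_algebra {c} (\<boxplus>\<^bsub>unit_emv\<^esub>) (emv_lam unit_emv c c) c c" if "c = 0 \<or> c = 1" for c
    proof -
      have p: "c \<boxplus>\<^bsub>unit_emv\<^esub> c = c" using that by (auto simp: unit_emv_def)
      have "comm_monoid \<lparr>carrier = {c}, mult = (\<boxplus>\<^bsub>unit_emv\<^esub>), one = c\<rparr>"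
        by (rule comm_monoidI) (use p in auto)
      then show ?thesis
        using unit_lam_point(2)[OF that] p by (intro mv_algebra.intro) auto
    qed
    then show ?thesis using 2 by (auto simp: unit_interval)
  qed
  fix x assume x: "x \<in> emv_interval unit_emv a b"
  show "\<exists>z. emv_is_min unit_emv (emv_complements unit_emv a b x) z"
    using cases
  proof cases
    case 1
    with x have "0 \<le> x" "x \<le> 1" by (auto simp: unit_interval)
    then show ?thesis using 1 unit_is_min by blast
  next
    case 2
    then have "x = a" using x by (auto simp: unit_interval)
    then show ?thesis using 2 unit_lam_point(1) by blast
  qed
next
  fix x assume "x \<in> carrier unit_emv"
  then show "\<exists>a\<in>emv_idem unit_emv. x \<preceq>\<^bsub>unit_emv\<^esub> a"
    by (auto simp: unit_idem unit_le) (auto simp: unit_emv_def)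
next
  fix x y z assume "x \<preceq>\<^bsub>unit_emv\<^esub> y" "z \<in> carrier unit_emv"
  then show "x \<boxplus>\<^bsub>unit_emv\<^esub> z \<preceq>\<^bsub>unit_emv\<^esub> y \<boxplus>\<^bsub>unit_emv\<^esub> z"
    by (auto simp: unit_le) (auto simp: unit_emv_def)
qed (auto simp: emv_le_def, auto simp: unit_emv_def min_def max_def)

end

theory Submission
  imports Defs
begin

text \<open>Given a maximal ideal \<open>I\<close>, choose an idempotent \<open>b \<notin> I\<close>. The MV-algebra \<open>[0, b]\<close>
  modulo \<open>I\<close> is an archimedean chain; adding its elements with carry gives the positive cone of
  Chang's ordered group, and, as in Hoelder's theorem, the average number of carries in the
  multiples of \<open>x\<close> is the value of a state \<open>\<sigma>\<close>. Then \<open>x \<mapsto> \<sigma>(x \<and> b)\<close> is a state-morphism with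
  kernel \<open>I\<close>, and \<open>\<theta>\<^sub>I\<close> is its kernel pair, so \<open>M/I\<close> is isomorphic to its image. Uniqueness
  reduces to the fact that a state-morphism is determined by its kernel.\<close>

section \<open>MV-algebras\<close>

text \<open>Since \<open>M\<close> may have no top element, there is no negation on
  \<open>M\<close>, only complements relative to an idempotent. This is why the state is built on
  one interval [0, b] and extended by meeting with \<open>b\<close>; maximality of \<open>I\<close>
  guarantees that nothing outside [0, b] is lost. Carries are counted because truncated multiples
  stabilise at the top and no longer show how often it was exceeded; the count is additive up to an
  error of 1, which averaging removes. That M/I is an EMV-algebra is not derived from general
  congruence theory: an injection into [0, 1] lets all axioms be read off from real numbers.
  Uniqueness in (i) holds because injectivity forces every such embedding to induce a state-morphism
  with kernel \<open>I\<close>.\<close>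

context mv_algebra
begin

notation plus (infixl "\<oplus>" 65)

text \<open>The Lukasiewicz product; in the unit interval it is max 0 (x + y - 1), the part of a sum
  that exceeds 1.\<close>

definition times :: "'a \<Rightarrow> 'a \<Rightarrow> 'a" (infixl "\<odot>" 70)
  where "x \<odot> y = neg (neg x \<oplus> neg y)"

text \<open>Truncated subtraction, max 0 (x - y) in the unit interval.\<close>

definition diff :: "'a \<Rightarrow> 'a \<Rightarrow> 'a" (infixl "\<ominus>" 65)
  where "x \<ominus> y = neg (neg x \<oplus> y)"

definition leq :: "'a \<Rightarrow> 'a \<Rightarrow> bool" (infix "\<lesssim>" 50)
  where "x \<lesssim> y \<longleftrightarrow> neg x \<oplus> y = one"

text \<open>In the unit interval this is the minimum: adding \<open>neg y\<close> truncates exactly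
  when \<open>x\<close> exceeds \<open>y\<close>, and the product with \<open>y\<close> undoes the
  shift.\<close>

definition inf :: "'a \<Rightarrow> 'a \<Rightarrow> 'a" (infixl "\<sqinter>" 70)
  where "x \<sqinter> y = (x \<oplus> neg y) \<odot> y"

abbreviation nmul :: "nat \<Rightarrow> 'a \<Rightarrow> 'a"
  where "nmul n x \<equiv> (plus x ^^ n) zero"

section \<open>Arithmetic, natural order and lattice operations of an MV-algebra\<close>

lemma zero_closed [simp]: "zero \<in> A"
  using monoid.one_closed[OF comm_monoid.axioms(1)[OF plus_comm_monoid]] by simp

lemma plus_closed [simp]: "x \<in> A \<Longrightarrow> y \<in> A \<Longrightarrow> x \<oplus> y \<in> A"
  using monoid.m_closed[OF comm_monoid.axioms(1)[OF plus_comm_monoid]] by simp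

lemma zero_plus [simp]: "x \<in> A \<Longrightarrow> zero \<oplus> x = x"
  using monoid.l_one[OF comm_monoid.axioms(1)[OF plus_comm_monoid]] by simp

lemma plus_zero [simp]: "x \<in> A \<Longrightarrow> x \<oplus> zero = x"
  using monoid.r_one[OF comm_monoid.axioms(1)[OF plus_comm_monoid]] by simp

lemma plus_comm: "x \<in> A \<Longrightarrow> y \<in> A \<Longrightarrow> x \<oplus> y = y \<oplus> x"
  using comm_monoid.m_comm[OF plus_comm_monoid] by simp

lemma plus_assoc: "x \<in> A \<Longrightarrow> y \<in> A \<Longrightarrow> z \<in> A \<Longrightarrow> x \<oplus> y \<oplus> z = x \<oplus> (y \<oplus> z)"
  using monoid.m_assoc[OF comm_monoid.axioms(1)[OF plus_comm_monoid]] by simp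

lemma plus_lcomm: "x \<in> A \<Longrightarrow> y \<in> A \<Longrightarrow> z \<in> A \<Longrightarrow> x \<oplus> (y \<oplus> z) = y \<oplus> (x \<oplus> z)"
  using comm_monoid.m_lcomm[OF plus_comm_monoid] by simp

lemmas plus_ac = plus_assoc plus_comm plus_lcomm

declare neg_closed [simp] one_closed [simp] neg_zero [simp] neg_neg [simp] plus_one [simp]

lemma neg_one [simp]: "neg one = zero"
  using neg_neg[of zero] by simp

lemma one_plus [simp]: "x \<in> A \<Longrightarrow> one \<oplus> x = one"
  using plus_comm[of one x] by simp

lemma plus_neg [simp]: "x \<in> A \<Longrightarrow> x \<oplus> neg x = one"
  using lukasiewicz[of x one] by simp

lemma neg_plus [simp]: "x \<in> A \<Longrightarrow> neg x \<oplus> x = one"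
  using plus_neg[of x] plus_comm[of x "neg x"] by simp

lemma neg_plus_left [simp]: "x \<in> A \<Longrightarrow> y \<in> A \<Longrightarrow> neg x \<oplus> (x \<oplus> y) = one"
  by (simp add: plus_assoc[symmetric])

lemma times_closed [simp]: "x \<in> A \<Longrightarrow> y \<in> A \<Longrightarrow> x \<odot> y \<in> A"
  by (simp add: times_def)

lemma diff_closed [simp]: "x \<in> A \<Longrightarrow> y \<in> A \<Longrightarrow> x \<ominus> y \<in> A"
  by (simp add: diff_def)

lemma inf_closed [simp]: "x \<in> A \<Longrightarrow> y \<in> A \<Longrightarrow> x \<sqinter> y \<in> A"
  by (simp add: inf_def)

lemma nmul_closed [simp]: "x \<in> A \<Longrightarrow> nmul n x \<in> A"
  by (induction n) simp_all

text \<open>The Lukasiewicz axiom read through truncated subtraction: both sides are the join of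
  \<open>x\<close> and \<open>y\<close>.\<close>

lemma diff_plus_comm: "x \<in> A \<Longrightarrow> y \<in> A \<Longrightarrow> (x \<ominus> y) \<oplus> y = (y \<ominus> x) \<oplus> x"
  using lukasiewicz[of x y] by (simp add: diff_def plus_comm)

lemma leq_refl [simp]: "x \<in> A \<Longrightarrow> x \<lesssim> x"
  by (simp add: leq_def)

lemma zero_leq [simp]: "x \<in> A \<Longrightarrow> zero \<lesssim> x"
  by (simp add: leq_def)

lemma leq_one [simp]: "x \<in> A \<Longrightarrow> x \<lesssim> one"
  by (simp add: leq_def)

lemma leq_plus [simp]: "x \<in> A \<Longrightarrow> y \<in> A \<Longrightarrow> x \<lesssim> x \<oplus> y" "x \<in> A \<Longrightarrow> y \<in> A \<Longrightarrow> x \<lesssim> y \<oplus> x"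
  by (simp_all add: leq_def plus_comm[of y x])

text \<open>Residuation: both sides unfold to \<open>neg x \<oplus> (y \<oplus> z) = one\<close>. It
  turns order estimates into statements about sums.\<close>

lemma diff_leq_iff: "x \<in> A \<Longrightarrow> y \<in> A \<Longrightarrow> z \<in> A \<Longrightarrow> x \<ominus> y \<lesssim> z \<longleftrightarrow> x \<lesssim> y \<oplus> z"
  by (simp add: leq_def diff_def plus_assoc)

lemma diff_plus_cancel: "x \<in> A \<Longrightarrow> y \<in> A \<Longrightarrow> x \<lesssim> y \<Longrightarrow> (y \<ominus> x) \<oplus> x = y"
  using diff_plus_comm[of x y] by (simp add: leq_def diff_def)

lemma leq_antisym: "x \<in> A \<Longrightarrow> y \<in> A \<Longrightarrow> x \<lesssim> y \<Longrightarrow> y \<lesssim> x \<Longrightarrow> x = y"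
  using diff_plus_cancel[of x y] by (simp add: leq_def diff_def)

lemma leq_trans:
  assumes "x \<in> A" "y \<in> A" "z \<in> A" "x \<lesssim> y" "y \<lesssim> z"
  shows "x \<lesssim> z"
proof -
  have "neg x \<oplus> z = (z \<ominus> y) \<oplus> (neg x \<oplus> y)"
    using assms diff_plus_cancel[of y z] by (metis diff_closed neg_closed plus_lcomm)
  then show ?thesis using assms by (simp add: leq_def)
qed

lemma plus_leq_mono:
  assumes "x \<in> A" "y \<in> A" "z \<in> A" "x \<lesssim> y"
  shows "x \<oplus> z \<lesssim> y \<oplus> z"
proof -
  have "y \<oplus> z = (x \<oplus> z) \<oplus> (y \<ominus> x)"
    using assms diff_plus_cancel[of x y] by (metis diff_closed plus_assoc plus_comm)
  then show ?thesis using assms by simp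
qed

lemma plus_leq_mono2:
  assumes "x \<in> A" "y \<in> A" "z \<in> A" "w \<in> A" "x \<lesssim> y" "z \<lesssim> w"
  shows "x \<oplus> z \<lesssim> y \<oplus> w"
  using assms plus_leq_mono[of x y z] plus_leq_mono[of z w y] leq_trans[of "x \<oplus> z" "y \<oplus> z" "y \<oplus> w"]
  by (simp add: plus_comm)

lemma neg_leq_iff [simp]: "x \<in> A \<Longrightarrow> y \<in> A \<Longrightarrow> neg x \<lesssim> neg y \<longleftrightarrow> y \<lesssim> x"
  by (simp add: leq_def plus_comm)

text \<open>Subtracting \<open>y\<close> is monotone, and \<open>z\<close> is recovered as
  \<open>(z \<ominus> y) \<oplus> y\<close>. Through \<open>neg_inf\<close> the statement dualises
  to \<open>inf_greatest\<close>.\<close>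

lemma diff_plus_leq:
  assumes "x \<in> A" "y \<in> A" "z \<in> A" "x \<lesssim> z" "y \<lesssim> z"
  shows "(x \<ominus> y) \<oplus> y \<lesssim> z"
proof -
  have "neg z \<oplus> y \<lesssim> neg x \<oplus> y"
    using assms by (intro plus_leq_mono) auto
  then have "x \<ominus> y \<lesssim> z \<ominus> y"
    using assms by (simp add: diff_def)
  then have "(x \<ominus> y) \<oplus> y \<lesssim> (z \<ominus> y) \<oplus> y"
    using assms by (intro plus_leq_mono) auto
  then show ?thesis using assms by (simp add: diff_plus_cancel)
qed

lemma neg_inf: "x \<in> A \<Longrightarrow> y \<in> A \<Longrightarrow> neg (x \<sqinter> y) = (neg x \<ominus> neg y) \<oplus> neg y"
  by (simp add: inf_def times_def diff_def)

lemma inf_leq2: "x \<in> A \<Longrightarrow> y \<in> A \<Longrightarrow> x \<sqinter> y \<lesssim> y"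
  by (subst neg_leq_iff[symmetric]) (auto simp: neg_inf)

lemma inf_comm: "x \<in> A \<Longrightarrow> y \<in> A \<Longrightarrow> x \<sqinter> y = y \<sqinter> x"
  using neg_inf[of x y] neg_inf[of y x] diff_plus_comm[of "neg x" "neg y"]
  by (metis inf_closed neg_closed neg_neg)

lemma inf_leq1: "x \<in> A \<Longrightarrow> y \<in> A \<Longrightarrow> x \<sqinter> y \<lesssim> x"
  using inf_leq2[of y x] by (simp add: inf_comm)

lemma inf_greatest:
  assumes "x \<in> A" "y \<in> A" "z \<in> A" "z \<lesssim> x" "z \<lesssim> y"
  shows "z \<lesssim> x \<sqinter> y"
  using assms by (subst neg_leq_iff[symmetric]) (auto simp: neg_inf intro!: diff_plus_leq)

lemma inf_absorb1: "x \<in> A \<Longrightarrow> y \<in> A \<Longrightarrow> x \<lesssim> y \<Longrightarrow> x \<sqinter> y = x"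
  by (intro leq_antisym inf_greatest) (auto simp: inf_leq1)

lemma plus_inf_leq:
  assumes "x \<in> A" "y \<in> A" "z \<in> A"
  shows "(x \<oplus> y) \<sqinter> (x \<oplus> z) \<lesssim> x \<oplus> (y \<sqinter> z)"
proof -
  have "((x \<oplus> y) \<sqinter> (x \<oplus> z)) \<ominus> x \<lesssim> y \<sqinter> z"
    using assms by (intro inf_greatest) (simp_all add: diff_leq_iff inf_leq1 inf_leq2)
  then show ?thesis using assms by (simp add: diff_leq_iff)
qed

text \<open>The left side is below both \<open>(x \<sqinter> z) \<oplus> x\<close> and
  \<open>(x \<sqinter> z) \<oplus> y\<close>, and \<open>plus_inf_leq\<close> pulls out the common
  summand. The inequality spreads disjointness from an element to its multiples, and later makes
  meeting with an idempotent additive.\<close>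

lemma inf_plus_leq:
  assumes "x \<in> A" "y \<in> A" "z \<in> A"
  shows "x \<sqinter> (y \<oplus> z) \<lesssim> (x \<sqinter> y) \<oplus> (x \<sqinter> z)"
proof -
  have 1: "x \<sqinter> (y \<oplus> z) \<lesssim> y \<oplus> (x \<sqinter> z)"
  proof (rule leq_trans[OF _ _ _ _ plus_inf_leq])
    show "x \<sqinter> (y \<oplus> z) \<lesssim> (y \<oplus> x) \<sqinter> (y \<oplus> z)"
      using assms by (intro inf_greatest) (auto intro: leq_trans[OF _ _ _ inf_leq1] simp: inf_leq2)
  qed (use assms in auto)
  have 2: "x \<sqinter> (y \<oplus> z) \<lesssim> x \<oplus> (x \<sqinter> z)"
    using assms by (auto intro: leq_trans[OF _ _ _ inf_leq1])
  have "x \<sqinter> (y \<oplus> z) \<lesssim> ((x \<sqinter> z) \<oplus> x) \<sqinter> ((x \<sqinter> z) \<oplus> y)"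
    using 1 2 assms by (intro inf_greatest) (auto simp: plus_comm)
  then have "x \<sqinter> (y \<oplus> z) \<lesssim> (x \<sqinter> z) \<oplus> (x \<sqinter> y)"
    using assms by (auto intro: leq_trans[OF _ _ _ _ plus_inf_leq])
  then show ?thesis using assms by (simp add: plus_comm)
qed

section \<open>The Lukasiewicz product and sums of three elements\<close>

lemma times_comm: "x \<in> A \<Longrightarrow> y \<in> A \<Longrightarrow> x \<odot> y = y \<odot> x"
  by (simp add: times_def plus_comm)

lemma times_assoc: "x \<in> A \<Longrightarrow> y \<in> A \<Longrightarrow> z \<in> A \<Longrightarrow> x \<odot> y \<odot> z = x \<odot> (y \<odot> z)"
  by (simp add: times_def plus_assoc)

lemma times_eq_zero_iff: "x \<in> A \<Longrightarrow> y \<in> A \<Longrightarrow> x \<odot> y = zero \<longleftrightarrow> x \<lesssim> neg y"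
  by (metis leq_def neg_closed neg_neg neg_one neg_zero plus_closed times_def)

lemma plus_eq_one_iff: "x \<in> A \<Longrightarrow> y \<in> A \<Longrightarrow> x \<oplus> y = one \<longleftrightarrow> neg x \<lesssim> y"
  by (simp add: leq_def)

lemma times_leq: "x \<in> A \<Longrightarrow> y \<in> A \<Longrightarrow> x \<odot> y \<lesssim> x"
  by (subst neg_leq_iff[symmetric]) (auto simp: times_def)

lemma times_one_imp: "x \<in> A \<Longrightarrow> y \<in> A \<Longrightarrow> x \<odot> y = one \<Longrightarrow> x = one"
  using times_leq[of x y] leq_antisym[of x one] by auto

text \<open>The next three identities say that \<open>a + b + c - 1\<close> is computed correctly by every
  bracketing; they yield associativity of addition with carry.\<close>

lemma plus_times_assoc:
  assumes "a \<in> A" "b \<in> A" "c \<in> A" "a \<odot> b = zero" "b \<odot> c = zero"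
  shows "(a \<oplus> b) \<odot> c = a \<odot> (b \<oplus> c)"
proof -
  \<comment> \<open>By the definition of \<open>\<sqinter>\<close>, \<open>a\<close> is
    \<open>(a \<oplus> b) \<odot> neg b\<close> and \<open>c\<close> is
    \<open>(c \<oplus> b) \<odot> neg b\<close>; both sides of the goal become the product of
    \<open>a \<oplus> b\<close>, \<open>neg b\<close> and \<open>b \<oplus> c\<close>.\<close>
  have a: "a \<sqinter> neg b = a"
    using assms by (intro inf_absorb1) (auto simp: times_eq_zero_iff)
  have c: "c \<sqinter> neg b = c"
    using assms times_comm[of b c] by (intro inf_absorb1) (auto simp: times_eq_zero_iff)
  have "(a \<oplus> b) \<odot> c = (a \<oplus> b) \<odot> (neg b \<odot> (c \<oplus> b))"
    using assms c times_comm[of "neg b" "c \<oplus> b"] by (simp add: inf_def)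
  also have "\<dots> = a \<odot> (b \<oplus> c)"
    using assms a by (simp add: inf_def times_assoc[symmetric] plus_comm[of c b])
  finally show ?thesis .
qed

lemma times_plus_assoc:
  assumes "a \<in> A" "b \<in> A" "c \<in> A" "a \<oplus> b = one" "b \<oplus> c = one"
  shows "a \<odot> b \<oplus> c = a \<oplus> b \<odot> c"
proof -
  have "(neg a \<oplus> neg b) \<odot> neg c = neg a \<odot> (neg b \<oplus> neg c)"
    using assms by (intro plus_times_assoc) (auto simp: times_def)
  then have "neg (a \<odot> b \<oplus> c) = neg (a \<oplus> b \<odot> c)"
    using assms by (simp add: times_def)
  then show ?thesis using assms by (metis neg_neg plus_closed times_closed)
qed

lemma times_plus_mixed_assoc:
  assumes "a \<in> A" "b \<in> A" "c \<in> A" "a \<oplus> b = one" "b \<odot> c = zero"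
  shows "a \<odot> b \<oplus> c = a \<odot> (b \<oplus> c)"
proof -
  \<comment> \<open>Here \<open>e\<close> stands for a + b - 1, so \<open>b\<close> is
    \<open>e \<oplus> neg a\<close> and \<open>neg b\<close> is \<open>a \<ominus> e\<close>, both
    without truncation. As \<open>c\<close> fits under \<open>neg b\<close>,
    \<open>c \<oplus> e\<close> stays below \<open>a\<close>, and its meet with \<open>a\<close>
    unfolds to the right-hand side.\<close>
  define e where "e = a \<odot> b"
  have e: "e \<in> A" using assms by (simp add: e_def)
  have b: "e \<oplus> neg a = b"
    using assms diff_plus_cancel[of "neg a" b]
    by (simp add: e_def plus_eq_one_iff diff_def times_def plus_comm)
  have "c \<lesssim> neg b" using assms times_comm[of b c] by (simp add: times_eq_zero_iff)
  also have nb: "neg b = a \<ominus> e" using b assms e by (metis diff_def plus_comm neg_closed)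
  finally have "c \<oplus> e \<lesssim> (a \<ominus> e) \<oplus> e"
    using assms e by (intro plus_leq_mono) auto
  also have "(a \<ominus> e) \<oplus> e = a"
    using assms by (intro diff_plus_cancel) (auto simp: e_def times_leq)
  finally have "(c \<oplus> e) \<sqinter> a = c \<oplus> e"
    using assms e by (intro inf_absorb1) auto
  then show ?thesis
    using assms e times_comm[of a "b \<oplus> c"] b
    by (simp add: inf_def plus_ac flip: e_def)
qed

lemma inf_eq_diff_diff: "x \<in> A \<Longrightarrow> y \<in> A \<Longrightarrow> x \<sqinter> y = x \<ominus> (x \<ominus> y)"
  by (subst inf_comm) (auto simp: inf_def times_def diff_def plus_comm)

lemma diff_leq: "x \<in> A \<Longrightarrow> y \<in> A \<Longrightarrow> x \<ominus> y \<lesssim> x"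
  by (simp add: diff_leq_iff)

lemma inf_plus_diff: "x \<in> A \<Longrightarrow> y \<in> A \<Longrightarrow> (x \<sqinter> y) \<oplus> (x \<ominus> y) = x"
  by (simp add: inf_eq_diff_diff diff_plus_cancel diff_leq)

text \<open>The source of linearity in quotients. With \<open>m\<close> the common part of
  \<open>x\<close> and \<open>y\<close> and \<open>w\<close> the common part of the two excesses,
  \<open>m \<oplus> w\<close> is still below \<open>x\<close> and \<open>y\<close>, hence equal to
  \<open>m\<close>.\<close>

lemma diff_inf_diff:
  assumes "x \<in> A" "y \<in> A"
  shows "(x \<ominus> y) \<sqinter> (y \<ominus> x) = zero"
proof -
  define m w where "m = x \<sqinter> y" and "w = (x \<ominus> y) \<sqinter> (y \<ominus> x)"
  have c [simp]: "m \<in> A" "w \<in> A" using assms by (auto simp: m_def w_def)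
  have "w \<lesssim> x \<ominus> y" "w \<lesssim> y \<ominus> x"
    using assms by (auto simp: w_def inf_leq1 inf_leq2)
  then have "m \<oplus> w \<lesssim> m \<oplus> (x \<ominus> y)" "m \<oplus> w \<lesssim> m \<oplus> (y \<ominus> x)"
    using assms by (auto intro: plus_leq_mono2)
  moreover have "m \<oplus> (x \<ominus> y) = x" "m \<oplus> (y \<ominus> x) = y"
    using assms inf_plus_diff[of x y] inf_plus_diff[of y x] by (auto simp: m_def inf_comm)
  ultimately have "m \<oplus> w \<lesssim> m"
    using assms unfolding m_def by (auto intro: inf_greatest)
  then have mw: "w \<oplus> m = m"
    by (intro leq_antisym) (auto simp: plus_comm)
  \<comment> \<open>The equation \<open>w \<oplus> m = m\<close> alone does not give
    \<open>w = zero\<close>, since the sum might be truncated; a bound of \<open>w\<close> by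
    \<open>neg m\<close> excludes this.\<close>
  have "x \<ominus> y \<lesssim> neg m"
    using assms by (simp add: m_def inf_eq_diff_diff diff_def)
  then have "w \<lesssim> neg m"
    using assms \<open>w \<lesssim> x \<ominus> y\<close> leq_trans[of w "x \<ominus> y" "neg m"] by simp
  then have "w = w \<sqinter> neg m" by (simp add: inf_absorb1)
  also have "\<dots> = m \<odot> neg m" by (simp add: inf_def mw)
  finally show ?thesis by (simp add: w_def times_def)
qed

end

section \<open>Simple MV-chains\<close>

text \<open>\<open>f\<close> plays the part of a carry count. \<sigma> is its slope, the limit of
  \<open>f (p [^] n) / n\<close> written as a supremum; the first two conclusions pin it down up to
  1/n.\<close>

lemma quasi_additive_homogenization:
  fixes G (structure) and f :: "'a \<Rightarrow> real"
  assumes G: "comm_monoid G" and f1: "f \<one> = 0"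
    and lower: "\<And>p q. p \<in> carrier G \<Longrightarrow> q \<in> carrier G \<Longrightarrow> f p + f q \<le> f (p \<otimes> q)"
    and upper: "\<And>p q. p \<in> carrier G \<Longrightarrow> q \<in> carrier G \<Longrightarrow> f (p \<otimes> q) \<le> f p + f q + 1"
  obtains \<sigma> where
    "\<And>p n. p \<in> carrier G \<Longrightarrow> f (p [^] (n::nat)) \<le> real n * \<sigma> p"
    "\<And>p n. p \<in> carrier G \<Longrightarrow> real n * \<sigma> p \<le> f (p [^] (n::nat)) + 1"
    "\<And>p q. p \<in> carrier G \<Longrightarrow> q \<in> carrier G \<Longrightarrow> \<sigma> (p \<otimes> q) = \<sigma> p + \<sigma> q"
proof
  interpret comm_monoid G by fact
  define \<sigma> where "\<sigma> p = (SUP n\<in>{0<..}. f (p [^] (n::nat)) / real n)" for p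
  have pow: "real m * f p \<le> f (p [^] m) \<and> f (p [^] m) \<le> real m * f p + real m"
    if "p \<in> carrier G" for p and m :: nat
  proof (induction m)
    case (Suc m)
    then show ?case
      using lower[of "p [^] m" p] upper[of "p [^] m" p] that by (auto simp: algebra_simps)
  qed (use f1 in simp)
  \<comment> \<open>Both ratios are compared with \<open>f (p [^] (n * m))\<close>. Every lower
    estimate of the slope is thus at most every upper one, which bounds the supremum on both
    sides.\<close>
  have cross: "f (p [^] n) / real n \<le> (f (p [^] m) + 1) / real m"
    if "p \<in> carrier G" "n > 0" "m > 0" for p and n m :: nat
  proof -
    have "real m * f (p [^] n) \<le> f (p [^] (n * m))"
      using pow[of "p [^] n" m] that by (simp add: nat_pow_pow)
    also have "\<dots> \<le> real n * f (p [^] m) + real n"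
      using pow[of "p [^] m" n] that by (simp add: nat_pow_pow mult.commute)
    finally show ?thesis using that by (simp add: field_simps)
  qed
  show low: "f (p [^] n) \<le> real n * \<sigma> p" if "p \<in> carrier G" for p and n :: nat
  proof (cases "n = 0")
    case False
    have "f (p [^] n) / real n \<le> \<sigma> p"
      unfolding \<sigma>_def using False cross[OF that, of _ n]
      by (intro cSUP_upper) (auto intro!: bdd_aboveI2)
    then show ?thesis using False by (simp add: field_simps)
  qed (use f1 in simp)
  show up: "real n * \<sigma> p \<le> f (p [^] n) + 1" if "p \<in> carrier G" for p and n :: nat
  proof (cases "n = 0")
    case False
    have "\<sigma> p \<le> (f (p [^] n) + 1) / real n"
      unfolding \<sigma>_def using False cross[OF that, of _ n] by (intro cSUP_least) auto
    then show ?thesis using False by (simp add: field_simps)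
  qed (use f1 in simp)
  show "\<sigma> (p \<otimes> q) = \<sigma> p + \<sigma> q" if pq: "p \<in> carrier G" "q \<in> carrier G" for p q
  proof -
    let ?d = "\<sigma> (p \<otimes> q) - (\<sigma> p + \<sigma> q)"
    \<comment> \<open>All that matters about 3 is its independence of \<open>n\<close>: the errors
      of the estimates for the \<open>n\<close>-th powers do not grow, so \<open>?d\<close> must
      vanish.\<close>
    have "real n * \<bar>?d\<bar> \<le> 3" for n
    proof -
      have "(p \<otimes> q) [^] n = p [^] n \<otimes> q [^] n" using pq by (simp add: pow_mult_distrib m_comm)
      then have "\<bar>real n * ?d\<bar> \<le> 3"
        using low[of p n] low[of q n] low[of "p \<otimes> q" n] up[of p n] up[of q n] up[of "p \<otimes> q" n]
          lower[of "p [^] n" "q [^] n"] upper[of "p [^] n" "q [^] n"] pq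
        by (simp add: algebra_simps abs_le_iff)
      then show ?thesis by (simp add: abs_mult)
    qed
    then have "\<not> \<bar>?d\<bar> > 0" using ex_less_of_nat_mult[of "\<bar>?d\<bar>" 3] by (metis not_less)
    then show ?thesis by simp
  qed
qed

text \<open>These are the properties that division by a maximal ideal creates: \<open>linear\<close>
  comes from the disjoint differences, \<open>archimedean\<close> from maximality,
  \<open>nontrivial\<close> from properness.\<close>

locale simple_mv_chain = mv_algebra +
  assumes linear: "x \<in> A \<Longrightarrow> y \<in> A \<Longrightarrow> x \<lesssim> y \<or> y \<lesssim> x"
    and archimedean: "x \<in> A \<Longrightarrow> x \<noteq> zero \<Longrightarrow> \<exists>n. nmul n x = one"
    and nontrivial: "zero \<noteq> one"
begin

text \<open>Even a sum that just reaches \<open>one\<close> carries; fractional parts therefore stay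
  different from \<open>one\<close>, and no element of the cone has two representations.\<close>

definition carry_add :: "nat \<times> 'a \<Rightarrow> nat \<times> 'a \<Rightarrow> nat \<times> 'a" where
  "carry_add = (\<lambda>(m, a) (n, b).
     if a \<oplus> b = one then (Suc (m + n), a \<odot> b) else (m + n, a \<oplus> b))"

text \<open>The positive cone of Chang's totally ordered group: \<open>(m, a)\<close> stands for \<open>m + a\<close> with
  integer part \<open>m\<close> and fractional part \<open>a\<close>.\<close>

definition chang_monoid :: "(nat \<times> 'a) monoid" where
  "chang_monoid = \<lparr>carrier = UNIV \<times> (A - {one}), mult = carry_add, one = (0, zero)\<rparr>"

text \<open>In a chain either \<open>x \<lesssim> neg y\<close>, and the product vanishes, or
  \<open>neg y \<lesssim> x\<close>, and the sum is \<open>one\<close>. So neither branch of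
  \<open>carry_add\<close> loses information.\<close>

lemma plus_not_one: "x \<in> A \<Longrightarrow> y \<in> A \<Longrightarrow> x \<oplus> y \<noteq> one \<Longrightarrow> x \<odot> y = zero"
  using linear[of x "neg y"] plus_comm[of y x]
  by (auto simp: times_eq_zero_iff) (simp add: leq_def)

lemma times_not_one [simp]: "x \<in> A \<Longrightarrow> y \<in> A \<Longrightarrow> x \<noteq> one \<Longrightarrow> x \<odot> y \<noteq> one"
  using times_one_imp by blast

lemma plus_eq_one_absorb:
  assumes "a \<in> A" "b \<in> A" "c \<in> A" "a \<oplus> b = one"
  shows "a \<oplus> (b \<oplus> c) = one" "c \<oplus> (a \<oplus> b) = one"
  using assms by (simp_all add: plus_assoc[symmetric])

text \<open>The overflow between \<open>a\<close> and \<open>b\<close> uses up the only carry of the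
  triple, so adding \<open>c\<close> afterwards causes no second one.\<close>

lemma carry_add_mixed:
  assumes "a \<in> A" "b \<in> A" "c \<in> A" "a \<noteq> one" "a \<oplus> b = one" "b \<oplus> c \<noteq> one"
  shows "a \<odot> b \<oplus> c = a \<odot> (b \<oplus> c)" "a \<odot> b \<oplus> c \<noteq> one"
proof -
  show "a \<odot> b \<oplus> c = a \<odot> (b \<oplus> c)"
    using assms plus_not_one[of b c] by (intro times_plus_mixed_assoc) auto
  then show "a \<odot> b \<oplus> c \<noteq> one" using assms by simp
qed

lemma carry_add_assoc_left:
  assumes "a \<in> A - {one}" "b \<in> A - {one}" "c \<in> A - {one}"
  shows "carry_add (carry_add (k, a) (m, b)) (n, c) = carry_add (k, a) (carry_add (m, b) (n, c))"
proof -
  have abc [simp]: "a \<in> A" "a \<noteq> one" "b \<in> A" "b \<noteq> one" "c \<in> A" "c \<noteq> one" using assms by auto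
  \<comment> \<open>The cases say which adjacent pairs overflow. Each bracketing identity settles
    one of them, and the third case is the mirror image of the second under commutativity.\<close>
  consider "a \<oplus> b = one" "b \<oplus> c = one" | "a \<oplus> b = one" "b \<oplus> c \<noteq> one"
    | "a \<oplus> b \<noteq> one" "b \<oplus> c = one" | "a \<oplus> b \<noteq> one" "b \<oplus> c \<noteq> one" by blast
  then show ?thesis
  proof cases
    case 1
    then show ?thesis
      using times_plus_assoc[of a b c] by (simp add: carry_add_def times_assoc)
  next
    case 2
    then show ?thesis
      using carry_add_mixed[of a b c] plus_eq_one_absorb[of a b c] by (simp add: carry_add_def)
  next
    case 3
    then show ?thesis
      using carry_add_mixed[of c b a] plus_eq_one_absorb[of b c a]
        plus_comm[of b c] plus_comm[of b a] plus_comm[of "b \<odot> c" a] times_comm[of c b]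
        times_comm[of c "a \<oplus> b"]
      by (simp add: carry_add_def plus_assoc)
  next
    case 4
    then show ?thesis
      using plus_not_one plus_times_assoc[of a b c] by (simp add: carry_add_def plus_assoc)
  qed
qed

lemma chang_comm_monoid: "comm_monoid chang_monoid"
proof (rule comm_monoidI)
  fix p q r assume "p \<in> carrier chang_monoid" "q \<in> carrier chang_monoid" "r \<in> carrier chang_monoid"
  then show "p \<otimes>\<^bsub>chang_monoid\<^esub> q \<otimes>\<^bsub>chang_monoid\<^esub> r = p \<otimes>\<^bsub>chang_monoid\<^esub> (q \<otimes>\<^bsub>chang_monoid\<^esub> r)"
    using carry_add_assoc_left by (cases p; cases q; cases r) (simp add: chang_monoid_def)
qed (auto simp: chang_monoid_def carry_add_def plus_comm times_comm nontrivial split: if_splits)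

text \<open>Without a carry every step took the branch of plain addition. An element of slope 0
  never carries, which will contradict \<open>archimedean\<close>.\<close>

lemma chang_pow_no_carry:
  assumes "x \<in> A" "x \<noteq> one" "fst ((0, x) [^]\<^bsub>chang_monoid\<^esub> (n::nat)) = 0"
  shows "snd ((0, x) [^]\<^bsub>chang_monoid\<^esub> n) = nmul n x"
  using assms(3)
proof (induction n)
  case (Suc n)
  interpret comm_monoid chang_monoid by (rule chang_comm_monoid)
  show ?case using Suc assms
    by (auto simp: chang_monoid_def carry_add_def case_prod_beta plus_comm split: if_splits)
qed (simp add: chang_monoid_def)

lemma simple_chain_embedding:
  obtains s :: "'a \<Rightarrow> real" where
    "\<And>x. x \<in> A \<Longrightarrow> 0 \<le> s x" "s one = 1"
    "\<And>x. x \<in> A \<Longrightarrow> s (neg x) = 1 - s x"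
    "\<And>x y. x \<in> A \<Longrightarrow> y \<in> A \<Longrightarrow> s (x \<oplus> y) = min 1 (s x + s y)"
    "\<And>x. x \<in> A \<Longrightarrow> s x = 0 \<Longrightarrow> x = zero"
proof -
  interpret C: comm_monoid chang_monoid by (rule chang_comm_monoid)
  let ?C = "carrier chang_monoid"
  have carr: "(m, a) \<in> ?C \<longleftrightarrow> a \<in> A \<and> a \<noteq> one" for m a by (auto simp: chang_monoid_def)
  have mult: "p \<otimes>\<^bsub>chang_monoid\<^esub> q = carry_add p q" for p q by (simp add: chang_monoid_def)
  obtain \<sigma> where low: "\<And>p n. p \<in> ?C \<Longrightarrow> real (fst (p [^]\<^bsub>chang_monoid\<^esub> (n::nat))) \<le> real n * \<sigma> p"
    and up: "\<And>p n. p \<in> ?C \<Longrightarrow> real n * \<sigma> p \<le> real (fst (p [^]\<^bsub>chang_monoid\<^esub> (n::nat))) + 1"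
    and add: "\<And>p q. p \<in> ?C \<Longrightarrow> q \<in> ?C \<Longrightarrow> \<sigma> (p \<otimes>\<^bsub>chang_monoid\<^esub> q) = \<sigma> p + \<sigma> q"
    by (rule quasi_additive_homogenization[OF chang_comm_monoid, of "\<lambda>p. real (fst p)"])
       (auto simp: chang_monoid_def carry_add_def split: if_splits)
  have C0 [simp]: "(m, zero) \<in> ?C" for m using nontrivial by (simp add: carr)
  have z: "\<sigma> (0, zero) = 0"
    using add[of "(0, zero)" "(0, zero)"] nontrivial by (simp add: mult carry_add_def)
  have Suc: "\<sigma> (Suc m, a) = \<sigma> (m, a) + \<sigma> (1, zero)" if "a \<in> A" "a \<noteq> one" for m a
    using add[of "(m, a)" "(1, zero)"] that by (simp add: mult carry_add_def carr nontrivial)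
  have pow1: "(1, zero) [^]\<^bsub>chang_monoid\<^esub> n = (n, zero)" for n :: nat
    using nontrivial by (induction n) (auto simp: chang_monoid_def carry_add_def)
  have unit: "\<sigma> (1, zero) = 1"
  proof (rule antisym)
    show "1 \<le> \<sigma> (1, zero)" using low[of "(1, zero)" 1] by simp
    have "real n * (\<sigma> (1, zero) - 1) \<le> 1" for n
      using up[of "(1, zero)" n] by (simp add: pow1 algebra_simps del: One_nat_def)
    then show "\<sigma> (1, zero) \<le> 1"
      using ex_less_of_nat_mult[of "\<sigma> (1, zero) - 1" 1] by (metis diff_gt_0_iff_gt not_less)
  qed
  \<comment> \<open>A real equation without truncation on the left, involving both sum and product.
    The rules for \<open>neg\<close> (where the sum is \<open>one\<close> and the product
    \<open>zero\<close>) and for \<open>\<oplus>\<close> are read off from it.\<close>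
  have carry: "\<sigma> (0, x) + \<sigma> (0, y) = (if x \<oplus> y = one then 1 + \<sigma> (0, x \<odot> y) else \<sigma> (0, x \<oplus> y))"
    if "x \<in> A" "y \<in> A" "x \<noteq> one" "y \<noteq> one" for x y
    using add[of "(0, x)" "(0, y)"] that Suc[of "x \<odot> y" 0] unit
    by (auto simp: mult carry_add_def carr)
  have nonneg: "0 \<le> \<sigma> (0, x)" and le1: "\<sigma> (0, x) \<le> 1" if "x \<in> A" "x \<noteq> one" for x
    using that low[of "(0, x)" 1] up[of "(0, x)" 1] by (auto simp: carr)
  \<comment> \<open>\<open>one\<close> is not a fractional part; it corresponds to
    \<open>(1, zero)\<close>, whose slope is 1.\<close>
  define s where "s x = (if x = one then 1 else \<sigma> (0, x))" for x
  show thesis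
  proof
    fix x assume x: "x \<in> A"
    show "0 \<le> s x" using nonneg x by (simp add: s_def)
    show "s (neg x) = 1 - s x"
    proof (cases "x = one \<or> x = zero")
      case True
      then show ?thesis using z nontrivial by (auto simp: s_def)
    next
      case False
      then have "neg x \<noteq> one" using x by (metis neg_neg neg_one)
      then show ?thesis using carry[of x "neg x"] x False z by (simp add: s_def times_def)
    qed
    show "x = zero" if "s x = 0"
    proof (rule ccontr)
      assume "x \<noteq> zero"
      \<comment> \<open>With slope 0 no power of \<open>(0, x)\<close> has a carry, so the
        \<open>n\<close>-th one would have fractional part \<open>nmul n x = one\<close>, which the
        carrier excludes.\<close>
      then obtain n where n: "nmul n x = one" using archimedean x by blast
      have x1: "x \<noteq> one" "\<sigma> (0, x) = 0" using that by (auto simp: s_def split: if_splits)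
      then have "fst ((0, x) [^]\<^bsub>chang_monoid\<^esub> n) = 0" using low[of "(0, x)" n] x by (simp add: carr)
      then have "snd ((0, x) [^]\<^bsub>chang_monoid\<^esub> n) = one" using chang_pow_no_carry x x1 n by metis
      moreover have "(0, x) [^]\<^bsub>chang_monoid\<^esub> n \<in> ?C" using x x1 by (simp add: carr)
      ultimately show False by (auto simp: chang_monoid_def)
    qed
    fix y assume y: "y \<in> A"
    show "s (x \<oplus> y) = min 1 (s x + s y)"
      using x y carry[of x y] nonneg[of x] nonneg[of y] nonneg[of "x \<odot> y"] le1[of "x \<oplus> y"]
      by (auto simp: s_def)
  qed (simp add: s_def)
qed

end

section \<open>States of MV-algebras from maximal ideals\<close>

text \<open>\<open>r\<close> stands for the choice of a representative in each class of a
  congruence. The quotient is thus realised on a subset of \<open>A\<close>, with elements of the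
  same type instead of classes.\<close>

lemma (in mv_algebra) retract_mv_algebra:
  assumes r [simp]: "\<And>x. x \<in> A \<Longrightarrow> r x \<in> A" "\<And>x. x \<in> A \<Longrightarrow> r (r x) = r x"
    "\<And>x y. x \<in> A \<Longrightarrow> y \<in> A \<Longrightarrow> r (r x \<oplus> y) = r (x \<oplus> y)"
    "\<And>x. x \<in> A \<Longrightarrow> r (neg (r x)) = r (neg x)"
  shows "mv_algebra (r ` A) (\<lambda>x y. r (x \<oplus> y)) (\<lambda>x. r (neg x)) (r zero) (r one)"
proof -
  have r2 [simp]: "r (y \<oplus> r x) = r (y \<oplus> x)" if "x \<in> A" "y \<in> A" for x y
    using that r(3)[of x y] by (simp add: plus_comm)
  show ?thesis
  proof (rule mv_algebra.intro)
    show "comm_monoid \<lparr>carrier = r ` A, mult = \<lambda>x y. r (x \<oplus> y), one = r zero\<rparr>"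
      by (rule comm_monoidI) (auto simp: plus_assoc, simp add: plus_comm)
  qed (auto simp: lukasiewicz)
qed

text \<open>The two differences are disjoint, and so is the second from every multiple of the first.
  If the first is outside \<open>J\<close>, the negation of some multiple is in \<open>J\<close>,
  and the second difference lies below it.\<close>

lemma (in mv_algebra) maximal_ideal_linear:
  assumes zero: "zero \<in> J" and down: "\<And>x y. x \<in> A \<Longrightarrow> y \<in> J \<Longrightarrow> x \<lesssim> y \<Longrightarrow> x \<in> J"
    and max: "\<And>x. x \<in> A \<Longrightarrow> x \<notin> J \<Longrightarrow> \<exists>n. neg (nmul n x) \<in> J"
    and xy: "x \<in> A" "y \<in> A" "x \<ominus> y \<notin> J"
  shows "y \<ominus> x \<in> J"
proof -
  define u v where "u = x \<ominus> y" and "v = y \<ominus> x"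
  have c [simp]: "u \<in> A" "v \<in> A" and uv: "v \<sqinter> u = zero"
    using xy diff_inf_diff[of y x] by (auto simp: u_def v_def)
  have nu: "v \<sqinter> nmul n u = zero" for n
  proof (induction n)
    case 0
    then show ?case using inf_leq2[of v zero] by (intro leq_antisym) auto
  next
    case (Suc n)
    then show ?case using inf_plus_leq[of v u "nmul n u"] uv by (intro leq_antisym) auto
  qed
  obtain n where n: "neg (nmul n u) \<in> J" using max[of u] xy by (auto simp: u_def)
  \<comment> \<open>\<open>one\<close> is split into a multiple of \<open>u\<close>, which is
    disjoint from \<open>v\<close>, and its negation.\<close>
  have "v \<sqinter> (nmul n u \<oplus> neg (nmul n u)) \<lesssim> (v \<sqinter> nmul n u) \<oplus> (v \<sqinter> neg (nmul n u))"
    by (intro inf_plus_leq) auto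
  then have "v \<lesssim> v \<sqinter> neg (nmul n u)" by (simp add: nu inf_absorb1)
  then have "v \<lesssim> neg (nmul n u)" by (rule leq_trans[rotated 3]) (auto intro: inf_leq2)
  then show ?thesis using down n by (simp add: v_def[symmetric])
qed

text \<open>\<open>max\<close> expresses maximality of \<open>J\<close>: every element outside
  \<open>J\<close> has a multiple congruent to \<open>one\<close>. It makes the quotient both a
  chain and archimedean.\<close>

lemma (in mv_algebra) maximal_ideal_state:
  assumes zero: "zero \<in> J" and down: "\<And>x y. x \<in> A \<Longrightarrow> y \<in> J \<Longrightarrow> x \<lesssim> y \<Longrightarrow> x \<in> J"
    and add: "\<And>x y. x \<in> J \<Longrightarrow> y \<in> J \<Longrightarrow> x \<oplus> y \<in> J"
    and sub: "J \<subseteq> A" and one: "one \<notin> J"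
    and max: "\<And>x. x \<in> A \<Longrightarrow> x \<notin> J \<Longrightarrow> \<exists>n. neg (nmul n x) \<in> J"
  obtains s :: "'a \<Rightarrow> real" where
    "\<And>x. x \<in> A \<Longrightarrow> 0 \<le> s x" "s one = 1"
    "\<And>x. x \<in> A \<Longrightarrow> s (neg x) = 1 - s x"
    "\<And>x y. x \<in> A \<Longrightarrow> y \<in> A \<Longrightarrow> s (x \<oplus> y) = min 1 (s x + s y)"
    "\<And>x. x \<in> A \<Longrightarrow> s x = 0 \<longleftrightarrow> x \<in> J"
proof -
  define rel where "rel x y \<longleftrightarrow> x \<ominus> y \<in> J \<and> y \<ominus> x \<in> J" for x y
  have sym: "rel x y \<Longrightarrow> rel y x" for x y by (auto simp: rel_def)
  have refl: "rel x x" if "x \<in> A" for x using that zero by (simp add: rel_def diff_def)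
  \<comment> \<open>The triangle inequality for truncated differences, obtained by
    residuation.\<close>
  have diff_trans: "x \<ominus> z \<in> J" if "x \<ominus> y \<in> J" "y \<ominus> z \<in> J" "x \<in> A" "y \<in> A" "z \<in> A" for x y z
  proof (rule down[OF _ add[OF that(1,2)]])
    have "x \<lesssim> (x \<ominus> y) \<oplus> y" "y \<lesssim> (y \<ominus> z) \<oplus> z"
      using that by (simp_all add: diff_leq_iff[symmetric] plus_comm)
    then have "x \<lesssim> (x \<ominus> y) \<oplus> ((y \<ominus> z) \<oplus> z)"
      using that leq_trans[of x "(x \<ominus> y) \<oplus> y"] plus_leq_mono2 by simp
    then show "x \<ominus> z \<lesssim> (x \<ominus> y) \<oplus> (y \<ominus> z)" using that by (simp add: diff_leq_iff plus_ac)
  qed (use that in auto)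
  have trans: "rel x z" if "rel x y" "rel y z" "x \<in> A" "y \<in> A" "z \<in> A" for x y z
    using that diff_trans[of x y z] diff_trans[of z y x] by (auto simp: rel_def)
  have rel_neg: "rel (neg x) (neg y)" if "rel x y" "x \<in> A" "y \<in> A" for x y
    using that by (simp add: rel_def diff_def plus_comm)
  have diff_plus: "(x \<oplus> z) \<ominus> (y \<oplus> z) \<in> J" if "x \<ominus> y \<in> J" "x \<in> A" "y \<in> A" "z \<in> A" for x y z
  proof (rule down[OF _ that(1)])
    have "x \<oplus> z \<lesssim> ((x \<ominus> y) \<oplus> y) \<oplus> z"
      using that by (intro plus_leq_mono) (simp_all add: diff_leq_iff[symmetric] plus_comm)
    then show "(x \<oplus> z) \<ominus> (y \<oplus> z) \<lesssim> x \<ominus> y" using that by (simp add: diff_leq_iff plus_ac)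
  qed (use that in auto)
  have rel_plus: "rel (x \<oplus> z) (y \<oplus> z)" if "rel x y" "x \<in> A" "y \<in> A" "z \<in> A" for x y z
    using that diff_plus by (simp add: rel_def)
  have rel_one: "rel x one \<longleftrightarrow> neg x \<in> J" and rel_zero: "rel x zero \<longleftrightarrow> x \<in> J" if "x \<in> A" for x
    using that zero by (simp_all add: rel_def diff_def)

  \<comment> \<open>Congruent elements satisfy equivalent predicates here, so \<open>SOME\<close>
    returns the same representative for all of them.\<close>
  define r where "r x = (SOME y. y \<in> A \<and> rel x y)" for x
  have r: "r x \<in> A" "rel x (r x)" if "x \<in> A" for x
    using someI[of "\<lambda>y. y \<in> A \<and> rel x y" x] refl that unfolding r_def by auto
  have r_eq: "r x = r y \<longleftrightarrow> rel x y" if "x \<in> A" "y \<in> A" for x y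
  proof
    assume "rel x y"
    then have "rel x z \<longleftrightarrow> rel y z" if "z \<in> A" for z
      using that trans[of x y z] trans[of y x z] sym[of x y] \<open>x \<in> A\<close> \<open>y \<in> A\<close> by auto
    then show "r x = r y" unfolding r_def by metis
  next
    assume "r x = r y"
    then show "rel x y" using r[of x] r[of y] sym trans[of x "r x" y] that by metis
  qed
  have rr [simp]: "r x \<in> A" "r (r x) = r x" "r (neg (r x)) = r (neg x)"
    and rp [simp]: "y \<in> A \<Longrightarrow> r (r x \<oplus> y) = r (x \<oplus> y)" if "x \<in> A" for x y
    using that r[of x] by (auto simp: r_eq sym rel_neg rel_plus)
  have rp2 [simp]: "r (y \<oplus> r x) = r (y \<oplus> x)" if "x \<in> A" "y \<in> A" for x y
    using that rp[of x y] by (simp add: plus_comm)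

  let ?p = "\<lambda>x y. r (x \<oplus> y)" and ?n = "\<lambda>x. r (neg x)"
  interpret Q: mv_algebra "r ` A" ?p ?n "r zero" "r one"
    by (rule retract_mv_algebra) auto
  have nmul: "(?p (r x) ^^ n) (r zero) = r (nmul n x)" if "x \<in> A" for x n
    by (induction n) (use that in auto)
  have leq: "Q.leq (r x) (r y)" if "x \<ominus> y \<in> J" "x \<in> A" "y \<in> A" for x y
    using that by (simp add: Q.leq_def r_eq rel_one diff_def)
  interpret Q: simple_mv_chain "r ` A" ?p ?n "r zero" "r one"
  proof
    have "x \<ominus> y \<in> J \<or> y \<ominus> x \<in> J" if "x \<in> A" "y \<in> A" for x y
      using maximal_ideal_linear[of J x y] zero down max that by blast
    then show "Q.leq a b \<or> Q.leq b a" if "a \<in> r ` A" "b \<in> r ` A" for a b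
      using that leq by blast
    show "r zero \<noteq> r one" using one by (simp add: r_eq rel_one)
    fix a assume "a \<in> r ` A" "a \<noteq> r zero"
    then obtain x where x: "x \<in> A" "a = r x" by blast
    with \<open>a \<noteq> r zero\<close> have "x \<notin> J" by (simp add: r_eq rel_zero)
    with x obtain n where "neg (nmul n x) \<in> J" using max by blast
    then show "\<exists>n. (?p a ^^ n) (r zero) = r one"
      using x by (intro exI[of _ n]) (simp add: nmul r_eq rel_one)
  qed
  obtain s :: "'a \<Rightarrow> real" where s: "\<And>x. x \<in> A \<Longrightarrow> 0 \<le> s (r x)" "s (r one) = 1"
    "\<And>x. x \<in> A \<Longrightarrow> s (r (neg x)) = 1 - s (r x)"
    "\<And>x y. x \<in> A \<Longrightarrow> y \<in> A \<Longrightarrow> s (r (x \<oplus> y)) = min 1 (s (r x) + s (r y))"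
    "\<And>x. x \<in> A \<Longrightarrow> s (r x) = 0 \<Longrightarrow> r x = r zero"
  proof (rule Q.simple_chain_embedding, goal_cases)
    case (1 s)
    show thesis
    proof (rule 1(1)[of s])
      fix x assume x: "x \<in> A"
      show "0 \<le> s (r x)" "s (r x) = 0 \<Longrightarrow> r x = r zero" using 1 x by auto
      show "s (r (neg x)) = 1 - s (r x)" using 1(4)[of "r x"] x by simp
      show "s (r (x \<oplus> y)) = min 1 (s (r x) + s (r y))" if "y \<in> A" for y
        using 1(5)[of "r x" "r y"] x that by simp
    qed (fact 1)
  qed
  have s0: "s (r zero) = 0" using s(3)[of one] s(2) by simp
  show thesis
  proof (rule that[of "\<lambda>x. s (r x)"])
    fix x assume x: "x \<in> A"
    show "s (r x) = 0 \<longleftrightarrow> x \<in> J"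
      using x s(5)[of x] s0 r_eq[of x zero] rel_zero[of x] by auto
  qed (use s in auto)
qed

section \<open>EMV-algebras\<close>

context emv_algebra
begin

section \<open>Lattice order and addition of an EMV-algebra\<close>

lemma plus_closed [simp]: "x \<in> carrier M \<Longrightarrow> y \<in> carrier M \<Longrightarrow> x \<boxplus> y \<in> carrier M"
  using monoid.m_closed[OF comm_monoid.axioms(1)[OF plus_comm_monoid]] by simp

lemma zero_closed [simp]: "\<zero> \<in> carrier M"
  using monoid.one_closed[OF comm_monoid.axioms(1)[OF plus_comm_monoid]] by simp

lemma plus_zero [simp]: "x \<in> carrier M \<Longrightarrow> x \<boxplus> \<zero> = x" "x \<in> carrier M \<Longrightarrow> \<zero> \<boxplus> x = x"
  using monoid.r_one[OF comm_monoid.axioms(1)[OF plus_comm_monoid]]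
    monoid.l_one[OF comm_monoid.axioms(1)[OF plus_comm_monoid]] by simp_all

lemma plus_comm: "x \<in> carrier M \<Longrightarrow> y \<in> carrier M \<Longrightarrow> x \<boxplus> y = y \<boxplus> x"
  using comm_monoid.m_comm[OF plus_comm_monoid] by simp

lemma plus_assoc:
  "x \<in> carrier M \<Longrightarrow> y \<in> carrier M \<Longrightarrow> z \<in> carrier M \<Longrightarrow> x \<boxplus> y \<boxplus> z = x \<boxplus> (y \<boxplus> z)"
  using monoid.m_assoc[OF comm_monoid.axioms(1)[OF plus_comm_monoid]] by simp

lemma plus_lcomm:
  "x \<in> carrier M \<Longrightarrow> y \<in> carrier M \<Longrightarrow> z \<in> carrier M \<Longrightarrow> x \<boxplus> (y \<boxplus> z) = y \<boxplus> (x \<boxplus> z)"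
  using comm_monoid.m_lcomm[OF plus_comm_monoid] by simp

lemmas plus_ac = plus_assoc plus_comm plus_lcomm

declare join_closed [simp] meet_closed [simp]

lemma meet_idem [simp]: "x \<in> carrier M \<Longrightarrow> x \<curlywedge> x = x"
  using meet_absorb[of x "x \<curlywedge> x"] join_absorb[of x x] by simp

lemma le_refl [simp]: "x \<in> carrier M \<Longrightarrow> x \<preceq> x"
  by (simp add: emv_le_def)

lemma le_carrier: "x \<preceq> y \<Longrightarrow> x \<in> carrier M" "x \<preceq> y \<Longrightarrow> y \<in> carrier M"
  by (simp_all add: emv_le_def)

lemma le_antisym: "x \<preceq> y \<Longrightarrow> y \<preceq> x \<Longrightarrow> x = y"
  using meet_comm[of x y] by (simp add: emv_le_def)

lemma le_trans [trans]: "x \<preceq> y \<Longrightarrow> y \<preceq> z \<Longrightarrow> x \<preceq> z"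
  by (simp add: emv_le_def) (metis meet_assoc)

lemma meet_le1 [simp]: "x \<in> carrier M \<Longrightarrow> y \<in> carrier M \<Longrightarrow> x \<curlywedge> y \<preceq> x"
  unfolding emv_le_def by (metis meet_assoc meet_closed meet_comm meet_idem)

lemma meet_le2 [simp]: "x \<in> carrier M \<Longrightarrow> y \<in> carrier M \<Longrightarrow> x \<curlywedge> y \<preceq> y"
  using meet_le1[of y x] by (simp add: meet_comm)

lemma meet_greatest: "z \<preceq> x \<Longrightarrow> z \<preceq> y \<Longrightarrow> z \<preceq> x \<curlywedge> y"
  by (simp add: emv_le_def meet_assoc[symmetric])

lemma join_ge1 [simp]: "x \<in> carrier M \<Longrightarrow> y \<in> carrier M \<Longrightarrow> x \<preceq> x \<curlyvee> y"
  by (simp add: emv_le_def meet_absorb)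

lemma join_ge2 [simp]: "x \<in> carrier M \<Longrightarrow> y \<in> carrier M \<Longrightarrow> y \<preceq> x \<curlyvee> y"
  using join_ge1[of y x] by (simp add: join_comm)

lemma join_least: "x \<preceq> z \<Longrightarrow> y \<preceq> z \<Longrightarrow> x \<curlyvee> y \<preceq> z"
  by (simp add: emv_le_def) (metis join_closed meet_comm meet_distrib)

lemma le_plus [simp]:
  assumes "x \<in> carrier M" "y \<in> carrier M"
  shows "x \<preceq> x \<boxplus> y" "y \<preceq> x \<boxplus> y"
  using assms plus_mono[OF zero_least[of y], of x] plus_mono[OF zero_least[of x], of y]
  by (simp_all add: plus_comm)

lemma plus_mono2:
  assumes "x \<preceq> y" "z \<preceq> w"
  shows "x \<boxplus> z \<preceq> y \<boxplus> w"
proof -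
  note c = assms[THEN le_carrier(1)] assms[THEN le_carrier(2)]
  have "x \<boxplus> z \<preceq> y \<boxplus> z" using assms c by (intro plus_mono) auto
  also have "y \<boxplus> z \<preceq> y \<boxplus> w" using plus_mono[OF assms(2), of y] c by (simp add: plus_comm)
  finally show ?thesis .
qed

lemma idemI: "b \<in> carrier M \<Longrightarrow> b \<boxplus> b = b \<Longrightarrow> b \<in> emv_idem M"
  and idem_closed: "b \<in> emv_idem M \<Longrightarrow> b \<in> carrier M"
  and idem_plus [simp]: "b \<in> emv_idem M \<Longrightarrow> b \<boxplus> b = b"
  by (auto simp: emv_idem_def)

declare idem_closed [simp]

lemma zero_idem [simp]: "\<zero> \<in> emv_idem M"
  by (rule idemI) simp_all

lemma interval_iff: "x \<in> emv_interval M \<zero> b \<longleftrightarrow> x \<preceq> b"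
  using zero_least[of x] by (auto simp: emv_interval_def dest: le_carrier)

text \<open>An idempotent above the sum is above each summand. Statements about three elements can
  therefore be checked inside a single MV-algebra [0, d].\<close>

lemma common_idem:
  assumes "x \<in> carrier M" "y \<in> carrier M" "z \<in> carrier M"
  obtains d where "d \<in> emv_idem M" "x \<preceq> d" "y \<preceq> d" "z \<preceq> d"
proof -
  obtain d where d: "d \<in> emv_idem M" "x \<boxplus> y \<boxplus> z \<preceq> d"
    using below_idem[of "x \<boxplus> y \<boxplus> z"] assms by auto
  have xy: "x \<boxplus> y \<preceq> d" and "z \<preceq> d"
    using assms by (auto intro!: le_trans[OF _ d(2)])
  moreover have "x \<preceq> d" "y \<preceq> d"
    using assms by (auto intro!: le_trans[OF _ xy])
  ultimately show ?thesis using that d by blast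
qed

lemma idem_plus_le: "b \<in> emv_idem M \<Longrightarrow> x \<preceq> b \<Longrightarrow> y \<preceq> b \<Longrightarrow> x \<boxplus> y \<preceq> b"
  using plus_mono2[of x b y b] by simp

section \<open>Intervals below an idempotent as MV-algebras\<close>

lemma lam_is_min:
  assumes "b \<in> emv_idem M" "x \<preceq> b"
  shows "emv_is_min M (emv_complements M \<zero> b x) (emv_lam0 M b x)"
proof -
  have "\<exists>z. emv_is_min M (emv_complements M \<zero> b x) z"
    using assms by (intro lam_exists) (auto simp: interval_iff zero_least)
  then show ?thesis
    unfolding emv_lam_def by (rule theI'[OF ex_ex1I]) (auto simp: emv_is_min_def intro: le_antisym)
qed

lemma lam_le: "b \<in> emv_idem M \<Longrightarrow> x \<preceq> b \<Longrightarrow> emv_lam0 M b x \<preceq> b"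
  and plus_lam: "b \<in> emv_idem M \<Longrightarrow> x \<preceq> b \<Longrightarrow> x \<boxplus> emv_lam0 M b x = b"
  and lam_least: "b \<in> emv_idem M \<Longrightarrow> x \<preceq> b \<Longrightarrow> z \<preceq> b \<Longrightarrow> x \<boxplus> z = b \<Longrightarrow> emv_lam0 M b x \<preceq> z"
  using lam_is_min[of b x] by (auto simp: emv_is_min_def emv_complements_def interval_iff)

lemma lam_closed [simp]: "b \<in> emv_idem M \<Longrightarrow> x \<preceq> b \<Longrightarrow> emv_lam0 M b x \<in> carrier M"
  using lam_le le_carrier by blast

lemma mv_interval:
  "b \<in> emv_idem M \<Longrightarrow> mv_algebra (emv_interval M \<zero> b) (\<boxplus>) (emv_lam0 M b) \<zero> b"
  by (rule interval_mv) (auto simp: zero_least)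

text \<open>Passing from the MV-order to the lattice order rests on minimality of complements:
  \<open>x\<close>, the complement of its own complement, is the least \<open>z\<close> with
  \<open>emv_lam0 M b x \<boxplus> z = b\<close>.\<close>

lemma mv_leq:
  assumes b: "b \<in> emv_idem M" and xy: "x \<preceq> b" "y \<preceq> b"
  shows "mv_algebra.leq (\<boxplus>) (emv_lam0 M b) b x y \<longleftrightarrow> x \<preceq> y"
proof -
  interpret I: mv_algebra "emv_interval M \<zero> b" "(\<boxplus>)" "emv_lam0 M b" \<zero> b
    by (rule mv_interval[OF b])
  have c: "x \<in> carrier M" "y \<in> carrier M" using xy le_carrier by auto
  have lam: "emv_lam0 M b x \<preceq> b" "emv_lam0 M b (emv_lam0 M b x) = x"
    using I.neg_neg[of x] xy b by (auto simp: interval_iff lam_le)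
  show ?thesis
  proof
    assume "I.leq x y"
    then have "emv_lam0 M b x \<boxplus> y = b" by (simp add: I.leq_def)
    then show "x \<preceq> y" using lam_least[OF b lam(1) xy(2)] lam by simp
  next
    assume "x \<preceq> y"
    have "b = x \<boxplus> emv_lam0 M b x" using plus_lam b xy by simp
    also have "\<dots> \<preceq> y \<boxplus> emv_lam0 M b x" using \<open>x \<preceq> y\<close> b xy by (intro plus_mono) auto
    finally have "y \<boxplus> emv_lam0 M b x = b"
      using idem_plus_le[OF b xy(2) lam(1)] le_antisym by blast
    then show "I.leq x y" using c b xy by (simp add: I.leq_def plus_comm)
  qed
qed

lemma mv_inf:
  assumes b: "b \<in> emv_idem M" and xy: "x \<preceq> b" "y \<preceq> b"
  shows "mv_algebra.inf (\<boxplus>) (emv_lam0 M b) x y = x \<curlywedge> y"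
proof -
  interpret I: mv_algebra "emv_interval M \<zero> b" "(\<boxplus>)" "emv_lam0 M b" \<zero> b
    by (rule mv_interval[OF b])
  have c [simp]: "x \<in> carrier M" "y \<in> carrier M" using xy le_carrier by auto
  have m: "x \<curlywedge> y \<preceq> b" using xy le_trans[of "x \<curlywedge> y" x b] by simp
  have i: "I.inf x y \<preceq> b" using I.inf_closed[of x y] xy by (simp add: interval_iff)
  have "x \<curlywedge> y \<preceq> I.inf x y"
    using I.inf_greatest[of x y "x \<curlywedge> y"] xy m i b by (simp add: mv_leq interval_iff)
  moreover have "I.inf x y \<preceq> x \<curlywedge> y"
    using I.inf_leq1[of x y] I.inf_leq2[of x y] xy i b by (intro meet_greatest) (simp_all add: mv_leq interval_iff)
  ultimately show ?thesis by (rule le_antisym[symmetric])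
qed

lemma meet_plus_le:
  assumes "x \<in> carrier M" "y \<in> carrier M" "z \<in> carrier M"
  shows "x \<curlywedge> (y \<boxplus> z) \<preceq> (x \<curlywedge> y) \<boxplus> (x \<curlywedge> z)"
proof -
  obtain d where d: "d \<in> emv_idem M" "x \<preceq> d" "y \<preceq> d" "z \<preceq> d" using assms by (rule common_idem)
  interpret I: mv_algebra "emv_interval M \<zero> d" "(\<boxplus>)" "emv_lam0 M d" \<zero> d
    by (rule mv_interval[OF d(1)])
  have "x \<curlywedge> w \<preceq> d" if "w \<in> carrier M" for w
    using that d assms le_trans[of "x \<curlywedge> w" x d] by simp
  then show ?thesis
    using I.inf_plus_leq[of x y z] d assms
    by (simp add: interval_iff idem_plus_le mv_inf mv_leq)
qed

lemma meet_mono: "x \<preceq> y \<Longrightarrow> z \<preceq> w \<Longrightarrow> x \<curlywedge> z \<preceq> y \<curlywedge> w"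
  by (meson le_carrier le_trans meet_greatest meet_le1 meet_le2)

text \<open>One inequality is \<open>meet_plus_le\<close>, the other needs
  \<open>b \<boxplus> b = b\<close>. This additivity is what allows a state on [0, b] to be extended
  to \<open>M\<close> by meeting with \<open>b\<close>.\<close>

lemma meet_idem_plus:
  assumes "b \<in> emv_idem M" "x \<in> carrier M" "y \<in> carrier M"
  shows "(x \<boxplus> y) \<curlywedge> b = (x \<curlywedge> b) \<boxplus> (y \<curlywedge> b)"
proof (rule le_antisym)
  show "(x \<boxplus> y) \<curlywedge> b \<preceq> (x \<curlywedge> b) \<boxplus> (y \<curlywedge> b)"
    using assms meet_plus_le[of b x y] by (simp add: meet_comm)
  show "(x \<curlywedge> b) \<boxplus> (y \<curlywedge> b) \<preceq> (x \<boxplus> y) \<curlywedge> b"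
    using assms by (intro meet_greatest idem_plus_le plus_mono2) auto
qed

lemma idem_meet:
  assumes "b \<in> emv_idem M" "c \<in> emv_idem M"
  shows "b \<curlywedge> c \<in> emv_idem M"
  using assms meet_idem_plus[of c b b] by (intro idemI) simp_all

lemma zero_meet [simp]: "x \<in> carrier M \<Longrightarrow> \<zero> \<curlywedge> x = \<zero>"
  using zero_least[of x] by (simp add: emv_le_def)

text \<open>In [0, c] the meet is the product of \<open>b \<boxplus> b\<close> with the complement
  of \<open>b\<close>, and idempotence removes the repetition. So idempotents have Boolean
  complements.\<close>

lemma idem_meet_lam:
  assumes "b \<in> emv_idem M" "c \<in> emv_idem M" "b \<preceq> c"
  shows "b \<curlywedge> emv_lam0 M c b = \<zero>"
proof -
  interpret I: mv_algebra "emv_interval M \<zero> c" "(\<boxplus>)" "emv_lam0 M c" \<zero> c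
    by (rule mv_interval[OF assms(2)])
  have "I.inf b (emv_lam0 M c b) = \<zero>"
    using assms by (simp add: I.inf_def I.times_def interval_iff plus_lam lam_le)
  then show ?thesis using assms by (simp add: mv_inf lam_le)
qed

text \<open>As \<open>c\<close> need not be above \<open>b\<close>, only an inequality can be
  expected. A competitor for the complement of \<open>x\<close> in [0, c] is assembled from
  \<open>w \<curlywedge> c\<close>, lying in \<open>b\<close>, and \<open>q\<close>, lying outside
  \<open>b\<close>; minimality bounds the true complement by it, and meeting with \<open>b\<close>
  kills \<open>q\<close>.\<close>

lemma lam_meet_le:
  assumes b: "b \<in> emv_idem M" and c: "c \<in> emv_idem M" and x: "x \<preceq> c"
  shows "emv_lam0 M c x \<curlywedge> b \<preceq> emv_lam0 M b (x \<curlywedge> b)"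
proof -
  define w e q where "w = emv_lam0 M b (x \<curlywedge> b)" and "e = b \<curlywedge> c" and "q = emv_lam0 M c e"
  have e: "e \<in> emv_idem M" "e \<preceq> c" "e \<preceq> b" using b c by (auto simp: e_def idem_meet)
  have xb: "x \<in> carrier M" "x \<curlywedge> b \<preceq> b" using x b le_carrier by auto
  have w: "w \<in> carrier M" "w \<preceq> b" "(x \<curlywedge> b) \<boxplus> w = b"
    using b xb by (auto simp: w_def lam_le plus_lam)
  have q: "q \<in> carrier M" "q \<preceq> c" "e \<boxplus> q = c"
    using e c by (auto simp: q_def lam_le plus_lam)
  have [simp]: "b \<in> carrier M" "c \<in> carrier M" "e \<in> carrier M" using b c e by auto
  have le_c: "(w \<curlywedge> c) \<boxplus> q \<preceq> c" using w q c by (intro idem_plus_le) auto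
  have "e = ((x \<curlywedge> b) \<curlywedge> c) \<boxplus> (w \<curlywedge> c)"
    using w xb c meet_idem_plus[of c "x \<curlywedge> b" w] by (simp add: e_def)
  also have "\<dots> \<preceq> x \<boxplus> (w \<curlywedge> c)"
    using w xb le_trans[of "(x \<curlywedge> b) \<curlywedge> c" "x \<curlywedge> b" x] by (intro plus_mono) auto
  finally have "e \<boxplus> q \<preceq> x \<boxplus> (w \<curlywedge> c) \<boxplus> q" using q by (intro plus_mono) auto
  then have "c \<preceq> x \<boxplus> ((w \<curlywedge> c) \<boxplus> q)" using q w xb by (simp add: plus_assoc)
  then have "x \<boxplus> ((w \<curlywedge> c) \<boxplus> q) = c" using idem_plus_le[OF c x le_c] by (rule le_antisym[rotated])
  then have "emv_lam0 M c x \<preceq> (w \<curlywedge> c) \<boxplus> q" using c x le_c by (intro lam_least)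
  then have "emv_lam0 M c x \<curlywedge> b \<preceq> ((w \<curlywedge> c) \<boxplus> q) \<curlywedge> b" by (intro meet_mono) auto
  also have "\<dots> = ((w \<curlywedge> c) \<curlywedge> b) \<boxplus> (q \<curlywedge> b)" using b w q by (intro meet_idem_plus) auto
  also have "q \<curlywedge> b = \<zero>"
  proof -
    have "q \<curlywedge> b \<preceq> e \<curlywedge> q"
      using q le_trans[of "q \<curlywedge> b" q c] by (simp add: e_def meet_greatest)
    also have "\<dots> = \<zero>" using e c by (simp add: q_def idem_meet_lam)
    finally show ?thesis using q by (intro le_antisym) (auto simp: zero_least)
  qed
  also have "((w \<curlywedge> c) \<curlywedge> b) \<boxplus> \<zero> \<preceq> w"
    using w le_trans[of "(w \<curlywedge> c) \<curlywedge> b" "w \<curlywedge> c" w] by simp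
  finally show ?thesis by (simp add: w_def)
qed

section \<open>Multiples and generated ideals\<close>

abbreviation nmul :: "nat \<Rightarrow> 'a \<Rightarrow> 'a"
  where "nmul n x \<equiv> ((\<boxplus>) x ^^ n) \<zero>"

lemma nmul_closed [simp]: "x \<in> carrier M \<Longrightarrow> nmul n x \<in> carrier M"
  by (induction n) simp_all

lemma nmul_add: "x \<in> carrier M \<Longrightarrow> nmul (m + n) x = nmul m x \<boxplus> nmul n x"
  by (induction m) (simp_all add: plus_assoc)

lemma nmul_meet_idem:
  "b \<in> emv_idem M \<Longrightarrow> x \<in> carrier M \<Longrightarrow> nmul n x \<curlywedge> b = nmul n (x \<curlywedge> b)"
  by (induction n) (simp_all add: meet_idem_plus)

lemma ideal_closed: "emv_ideal M I \<Longrightarrow> x \<in> I \<Longrightarrow> x \<in> carrier M"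
  and ideal_down: "emv_ideal M I \<Longrightarrow> y \<in> I \<Longrightarrow> x \<preceq> y \<Longrightarrow> x \<in> I"
  and ideal_plus: "emv_ideal M I \<Longrightarrow> x \<in> I \<Longrightarrow> y \<in> I \<Longrightarrow> x \<boxplus> y \<in> I"
  by (auto simp: emv_ideal_def)

lemma ideal_zero: "emv_ideal M I \<Longrightarrow> \<zero> \<in> I"
  using zero_least by (auto simp: emv_ideal_def)

lemma ideal_nmul: "emv_ideal M I \<Longrightarrow> x \<in> I \<Longrightarrow> nmul n x \<in> I"
  by (induction n) (auto simp: ideal_zero ideal_plus)

text \<open>The elements below some \<open>i \<boxplus> nmul n x\<close> already form an ideal
  containing \<open>I\<close> and \<open>x\<close>. Maximality thereby becomes an inequality that
  can be cut down by an idempotent.\<close>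

lemma ideal_hull_insert:
  assumes I: "emv_ideal M I" and x: "x \<in> carrier M" and y: "y \<in> emv_ideal M hull (insert x I)"
  obtains i n where "i \<in> I" "y \<preceq> i \<boxplus> nmul n x"
proof -
  define K where "K = {y. \<exists>i\<in>I. \<exists>n. y \<preceq> i \<boxplus> nmul n x}"
  have I_le: "i \<preceq> i \<boxplus> nmul 0 x" if "i \<in> I" for i using ideal_closed[OF I] that by simp
  have "emv_ideal M K"
    unfolding emv_ideal_def
  proof (intro conjI allI impI ballI)
    show "K \<subseteq> carrier M" by (auto simp: K_def le_carrier)
    show "K \<noteq> {}" using I_le ideal_zero[OF I] unfolding K_def by blast
    show "u \<in> K" if "v \<in> K \<and> u \<preceq> v" for u v
      using that by (auto simp: K_def intro: le_trans)
    show "u \<boxplus> v \<in> K" if "u \<in> K" "v \<in> K" for u v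
    proof -
      obtain i m j n where *: "i \<in> I" "u \<preceq> i \<boxplus> nmul m x" "j \<in> I" "v \<preceq> j \<boxplus> nmul n x"
        using \<open>u \<in> K\<close> \<open>v \<in> K\<close> by (auto simp: K_def)
      have "u \<boxplus> v \<preceq> (i \<boxplus> nmul m x) \<boxplus> (j \<boxplus> nmul n x)" using * by (intro plus_mono2)
      also have "\<dots> = (i \<boxplus> j) \<boxplus> nmul (m + n) x"
        using * ideal_closed[OF I] x by (simp add: nmul_add plus_ac)
      finally show ?thesis using ideal_plus[OF I] * by (auto simp: K_def)
    qed
  qed
  moreover have "insert x I \<subseteq> K"
  proof -
    have "x \<preceq> \<zero> \<boxplus> nmul 1 x" using x by simp
    then show ?thesis using I_le ideal_zero[OF I] unfolding K_def by blast
  qed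
  ultimately have "emv_ideal M hull (insert x I) \<subseteq> K" by (intro hull_minimal)
  then show ?thesis using y that by (auto simp: K_def)
qed

text \<open>Otherwise \<open>b\<close> is below some \<open>i \<boxplus> nmul n x\<close>; meeting
  with \<open>b\<close> replaces \<open>x\<close> by \<open>x \<curlywedge> b\<close> and puts
  \<open>b\<close> into \<open>I\<close>. Hence \<open>I\<close> is recovered from its trace on
  [0, b].\<close>

lemma maximal_ideal_meet_idem:
  assumes I: "emv_maximal_ideal M I" and b: "b \<in> emv_idem M" "b \<notin> I"
    and x: "x \<in> carrier M" "x \<curlywedge> b \<in> I"
  shows "x \<in> I"
proof (rule ccontr)
  assume "x \<notin> I"
  have id: "emv_ideal M I" using I by (simp add: emv_maximal_ideal_def)
  have "b \<in> emv_ideal M hull (insert x I)"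
    using I x b \<open>x \<notin> I\<close> by (simp add: emv_maximal_ideal_def)
  then obtain i n where i: "i \<in> I" "b \<preceq> i \<boxplus> nmul n x" by (rule ideal_hull_insert[OF id x(1)])
  have [simp]: "i \<in> carrier M" using i ideal_closed[OF id] by blast
  have "b \<preceq> (i \<boxplus> nmul n x) \<curlywedge> b" using i b by (intro meet_greatest) auto
  also have "\<dots> = (i \<curlywedge> b) \<boxplus> nmul n (x \<curlywedge> b)"
    using x b by (simp add: meet_idem_plus nmul_meet_idem)
  finally show False
    using b x i ideal_down[OF id _ meet_le1[of i b]] ideal_plus[OF id] ideal_nmul[OF id]
      ideal_down[OF id] by (metis \<open>i \<in> carrier M\<close> idem_closed)
qed

end

section \<open>State-morphisms\<close>

lemma unit_emv_sel [simp]: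
  "carrier unit_emv = {0..1}" "emv_join unit_emv = max" "emv_meet unit_emv = min"
  "emv_plus unit_emv x y = min (x + y) 1" "emv_zero unit_emv = 0"
  by (simp_all add: unit_emv_def)

lemma unit_lam_idem:
  assumes "b = 0 \<or> b = 1" "0 \<le> x" "x \<le> b"
  shows "emv_lam unit_emv 0 b x = b - x"
  using assms unit_lam[of x] unit_lam_point(2)[of 0] by auto

context emv_algebra
begin

text \<open>Additivity sends an idempotent to 0 or 1, and below either of these complementation in
  the unit interval is subtraction.\<close>

lemma emv_hom_unit_iff:
  "emv_hom M unit_emv s \<longleftrightarrow>
     (\<forall>x\<in>carrier M. 0 \<le> s x \<and> s x \<le> 1) \<and>
     (\<forall>x\<in>carrier M. \<forall>y\<in>carrier M. s (x \<curlyvee> y) = max (s x) (s y)) \<and>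
     (\<forall>x\<in>carrier M. \<forall>y\<in>carrier M. s (x \<curlywedge> y) = min (s x) (s y)) \<and>
     (\<forall>x\<in>carrier M. \<forall>y\<in>carrier M. s (x \<boxplus> y) = min (s x + s y) 1) \<and>
     s \<zero> = 0 \<and>
     (\<forall>b\<in>emv_idem M. \<forall>x. x \<preceq> b \<longrightarrow> s (emv_lam0 M b x) = s b - s x)"
proof -
  have lam: "emv_lam0 unit_emv (s b) (s x) = s b - s x"
    if "\<forall>x\<in>carrier M. 0 \<le> s x \<and> s x \<le> 1"
      "\<forall>x\<in>carrier M. \<forall>y\<in>carrier M. s (x \<curlywedge> y) = min (s x) (s y)"
      "\<forall>x\<in>carrier M. \<forall>y\<in>carrier M. s (x \<boxplus> y) = min (s x + s y) 1"
      "b \<in> emv_idem M" "x \<preceq> b" for b x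
  proof -
    have "s b = min (s b + s b) 1" using that(3,4) by (metis idem_closed idem_plus)
    then have "s b = 0 \<or> s b = 1" by (auto simp: min_def split: if_splits)
    moreover have "s x \<le> s b" using that(2,5) by (metis emv_le_def min.cobounded2)
    ultimately show ?thesis using that le_carrier(1)[OF that(5)] by (simp add: unit_lam_idem)
  qed
  show ?thesis
    using lam
    by (auto simp: emv_hom_def emv_algebra_axioms unit_emv_algebra Ball_def Pi_iff interval_iff)
qed

lemma state_morphism_cong:
  assumes "\<And>x. x \<in> carrier M \<Longrightarrow> s x = t x"
  shows "state_morphism M s \<longleftrightarrow> state_morphism M t"
proof -
  have "s x = t x" if "x \<preceq> b" for x b using assms le_carrier that by blast
  then show ?thesis using assms by (auto simp: state_morphism_def emv_hom_unit_iff)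
qed

lemma mv_sup:
  assumes b: "b \<in> emv_idem M" and xy: "x \<preceq> b" "y \<preceq> b"
  shows "mv_algebra.diff (\<boxplus>) (emv_lam0 M b) x y \<boxplus> y = x \<curlyvee> y"
proof -
  interpret I: mv_algebra "emv_interval M \<zero> b" "(\<boxplus>)" "emv_lam0 M b" \<zero> b
    by (rule mv_interval[OF b])
  let ?j = "I.diff x y \<boxplus> y"
  have c [simp]: "x \<in> carrier M" "y \<in> carrier M" using xy le_carrier by auto
  have "x \<curlyvee> y \<preceq> b" using xy by (rule join_least)
  moreover have "?j \<preceq> b" using I.plus_closed[of "I.diff x y" y] I.diff_closed[of x y] xy by (simp add: interval_iff)
  moreover have "I.leq x ?j" "I.leq y ?j"
    using xy I.diff_leq_iff[of x y "I.diff x y"] I.diff_closed[of x y] I.leq_refl[of "I.diff x y"]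
    by (simp_all add: interval_iff I.plus_comm)
  ultimately show ?thesis
    using I.diff_plus_leq[of x y "x \<curlyvee> y"] xy b
    by (intro le_antisym join_least) (simp_all add: mv_leq interval_iff)
qed

lemma maximal_ideal_state_morphism:
  assumes I: "emv_maximal_ideal M I"
  obtains s where "state_morphism M s" "state_ker M s = I"
proof -
  have id: "emv_ideal M I" using I by (simp add: emv_maximal_ideal_def)
  obtain b where b: "b \<in> emv_idem M" "b \<notin> I"
    using I below_idem ideal_down[OF id] ideal_closed[OF id] unfolding emv_maximal_ideal_def by blast
  have [simp]: "b \<in> carrier M" using b by simp
  interpret B: mv_algebra "emv_interval M \<zero> b" "(\<boxplus>)" "emv_lam0 M b" \<zero> b
    by (rule mv_interval[OF b(1)])
  \<comment> \<open>Maximality is transferred from \<open>M\<close> to [0, b]. The element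
    \<open>i\<close> of \<open>I\<close> may lie outside the interval, but
    \<open>i \<curlywedge> b\<close> complements the multiple of \<open>x\<close> and hence bounds
    its least complement.\<close>
  have max: "\<exists>n. emv_lam0 M b (nmul n x) \<in> I \<and> emv_lam0 M b (nmul n x) \<preceq> b"
    if x: "x \<preceq> b" "x \<notin> I" for x
  proof -
    have xc: "x \<in> carrier M" using x le_carrier by blast
    then have "b \<in> emv_ideal M hull (insert x I)"
      using I x by (simp add: emv_maximal_ideal_def)
    then obtain i n where i: "i \<in> I" "b \<preceq> i \<boxplus> nmul n x" by (rule ideal_hull_insert[OF id xc])
    have [simp]: "i \<in> carrier M" using i ideal_closed[OF id] by blast
    have nx: "nmul n x \<preceq> b" using B.nmul_closed[of x n] x by (simp add: interval_iff)
    have "b \<preceq> (i \<boxplus> nmul n x) \<curlywedge> b" using i by (intro meet_greatest) auto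
    also have "\<dots> = (i \<curlywedge> b) \<boxplus> (nmul n x \<curlywedge> b)" using b xc by (simp add: meet_idem_plus)
    also have "\<dots> = nmul n x \<boxplus> (i \<curlywedge> b)" using nx xc by (simp add: emv_le_def plus_comm)
    finally have "nmul n x \<boxplus> (i \<curlywedge> b) = b"
      using idem_plus_le[OF b(1) nx, of "i \<curlywedge> b"] le_antisym by simp
    then have "emv_lam0 M b (nmul n x) \<preceq> i \<curlywedge> b" using b nx by (intro lam_least) auto
    then have "emv_lam0 M b (nmul n x) \<preceq> i" by (rule le_trans) simp
    then show ?thesis using ideal_down[OF id i(1)] b nx lam_le by blast
  qed
  obtain \<sigma> :: "'a \<Rightarrow> real" where \<sigma>: "\<And>x. x \<preceq> b \<Longrightarrow> 0 \<le> \<sigma> x" "\<sigma> b = 1"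
    "\<And>x. x \<preceq> b \<Longrightarrow> \<sigma> (emv_lam0 M b x) = 1 - \<sigma> x"
    "\<And>x y. x \<preceq> b \<Longrightarrow> y \<preceq> b \<Longrightarrow> \<sigma> (x \<boxplus> y) = min 1 (\<sigma> x + \<sigma> y)"
    "\<And>x. x \<preceq> b \<Longrightarrow> \<sigma> x = 0 \<longleftrightarrow> x \<in> I"
  proof (rule B.maximal_ideal_state[of "I \<inter> emv_interval M \<zero> b"], goal_cases)
    case (2 x y)
    then show ?case using b ideal_down[OF id] by (auto simp: interval_iff mv_leq)
  next
    case (6 x)
    then show ?case using max by (auto simp: interval_iff)
  next
    case (7 s)
    then show ?case by (auto simp: interval_iff)
  qed (use id b in \<open>auto simp: interval_iff ideal_zero ideal_plus idem_plus_le zero_least\<close>)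
  have \<sigma>_le1: "\<sigma> x \<le> 1" if "x \<preceq> b" for x
    using \<sigma>(1)[of "emv_lam0 M b x"] \<sigma>(3)[OF that] lam_le b that by auto
  have \<sigma>_meet: "\<sigma> (x \<curlywedge> y) = min (\<sigma> x) (\<sigma> y)" if "x \<preceq> b" "y \<preceq> b" for x y
  proof -
    have "x \<curlywedge> y = B.inf x y" using mv_inf b that by simp
    also have "\<sigma> \<dots> = min (\<sigma> x) (\<sigma> y)"
      using that b \<sigma>(1)[of x] \<sigma>(1)[of y] \<sigma>(3,4) \<sigma>_le1[of x] \<sigma>_le1[of y]
      by (simp add: B.inf_def B.times_def lam_le idem_plus_le min_def)
    finally show ?thesis .
  qed
  have \<sigma>_mono: "\<sigma> x \<le> \<sigma> y" if "x \<preceq> y" "y \<preceq> b" for x y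
    using \<sigma>_meet[of x y] that le_trans[of x y b] by (simp add: emv_le_def)
  have \<sigma>_join: "\<sigma> (x \<curlyvee> y) = max (\<sigma> x) (\<sigma> y)" if "x \<preceq> b" "y \<preceq> b" for x y
  proof -
    have "x \<curlyvee> y = B.diff x y \<boxplus> y" using mv_sup b that by simp
    also have "\<sigma> \<dots> = max (\<sigma> x) (\<sigma> y)"
      using that b \<sigma>(1)[of x] \<sigma>(1)[of y] \<sigma>(3,4) \<sigma>_le1[of x] \<sigma>_le1[of y]
      by (simp add: B.diff_def lam_le idem_plus_le max_def min_def)
    finally show ?thesis .
  qed
  have \<sigma>_zero: "\<sigma> \<zero> = 0" using \<sigma>(5)[of \<zero>] ideal_zero[OF id] by (simp add: zero_least)
  define s where "s x = \<sigma> (x \<curlywedge> b)" for x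
  have s_bounds: "0 \<le> s x" "s x \<le> 1" if "x \<in> carrier M" for x
    using \<sigma>(1) \<sigma>_le1 that by (auto simp: s_def)
  have s_join: "s (x \<curlyvee> y) = max (s x) (s y)" if "x \<in> carrier M" "y \<in> carrier M" for x y
    using that by (simp add: s_def meet_comm[of _ b] meet_distrib \<sigma>_join)
  have s_meet: "s (x \<curlywedge> y) = min (s x) (s y)" if "x \<in> carrier M" "y \<in> carrier M" for x y
  proof -
    have "(x \<curlywedge> y) \<curlywedge> b = (x \<curlywedge> b) \<curlywedge> (y \<curlywedge> b)"
      using that \<open>b \<in> carrier M\<close> by (metis meet_assoc meet_closed meet_comm meet_idem)
    then show ?thesis using that by (simp add: s_def \<sigma>_meet)
  qed
  have s_plus: "s (x \<boxplus> y) = min (s x + s y) 1" if "x \<in> carrier M" "y \<in> carrier M" for x y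
    using that b by (simp add: s_def meet_idem_plus \<sigma>(4) min.commute)
  \<comment> \<open>That \<open>x\<close> and its complement add up to \<open>c\<close> bounds the
    value from below. The upper bound, needed when \<open>s c = 1\<close>, comes from
    \<open>lam_meet_le\<close>.\<close>
  have s_lam: "s (emv_lam0 M c x) = s c - s x" if c: "c \<in> emv_idem M" and x: "x \<preceq> c" for c x
  proof -
    have [simp]: "x \<in> carrier M" "c \<in> carrier M" using c x le_carrier by auto
    have sum: "s c = min (s x + s (emv_lam0 M c x)) 1"
      using s_plus[of x "emv_lam0 M c x"] c x by (simp add: plus_lam)
    have "s c = min (s c + s c) 1" using s_plus[of c c] c by simp
    then consider "s c = 0" | "s c = 1" by (auto simp: min_def split: if_splits)
    then show ?thesis
    proof cases
      case 1
      then show ?thesis using sum s_bounds[of x] s_bounds[of "emv_lam0 M c x"] c x by simp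
    next
      case 2
      have "s (emv_lam0 M c x) \<le> \<sigma> (emv_lam0 M b (x \<curlywedge> b))"
        unfolding s_def using b c x by (intro \<sigma>_mono lam_meet_le lam_le) auto
      also have "\<dots> = 1 - s x" by (simp add: s_def \<sigma>(3))
      finally show ?thesis using sum 2 by (auto simp: min_def split: if_splits)
    qed
  qed
  have "emv_hom M unit_emv s"
    unfolding emv_hom_unit_iff using s_bounds s_join s_meet s_plus s_lam
    by (simp add: s_def[of \<zero>] \<sigma>_zero)
  moreover have "s b = 1" by (simp add: s_def \<sigma>(2))
  ultimately have "state_morphism M s" using \<open>b \<in> carrier M\<close> unfolding state_morphism_def by blast
  moreover have "state_ker M s = I"
  proof -
    have "s x = 0 \<longleftrightarrow> x \<in> I" if "x \<in> carrier M" for x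
      using that \<sigma>(5)[of "x \<curlywedge> b"] maximal_ideal_meet_idem[OF I b that] ideal_down[OF id, of x "x \<curlywedge> b"]
      by (auto simp: s_def)
    then show ?thesis using ideal_closed[OF id] by (auto simp: state_ker_def)
  qed
  ultimately show thesis by (rule that)
qed

section \<open>Kernels of state-morphisms\<close>

lemma
  assumes "state_morphism M s"
  shows state_bounds: "x \<in> carrier M \<Longrightarrow> 0 \<le> s x \<and> s x \<le> 1"
    and state_join: "x \<in> carrier M \<Longrightarrow> y \<in> carrier M \<Longrightarrow> s (x \<curlyvee> y) = max (s x) (s y)"
    and state_meet: "x \<in> carrier M \<Longrightarrow> y \<in> carrier M \<Longrightarrow> s (x \<curlywedge> y) = min (s x) (s y)"
    and state_plus: "x \<in> carrier M \<Longrightarrow> y \<in> carrier M \<Longrightarrow> s (x \<boxplus> y) = min (s x + s y) 1"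
    and state_zero: "s \<zero> = 0"
    and state_lam: "b \<in> emv_idem M \<Longrightarrow> x \<preceq> b \<Longrightarrow> s (emv_lam0 M b x) = s b - s x"
  using assms by (auto simp: state_morphism_def emv_hom_unit_iff)

lemma state_idem: "state_morphism M s \<Longrightarrow> b \<in> emv_idem M \<Longrightarrow> s b = 0 \<or> s b = 1"
  using state_plus[of s b b] by (auto simp: min_def split: if_splits)

lemma state_mono: "state_morphism M s \<Longrightarrow> x \<preceq> y \<Longrightarrow> s x \<le> s y"
  using state_meet[of s x y] by (auto simp: emv_le_def)

lemma state_nmul:
  "state_morphism M s \<Longrightarrow> x \<in> carrier M \<Longrightarrow> s (nmul n x) = min (real n * s x) 1"
proof (induction n)
  case (Suc n)
  then show ?case using state_bounds[of s x] by (auto simp: state_plus algebra_simps min_def)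
qed (simp add: state_zero)

lemma state_ker_ideal:
  assumes s: "state_morphism M s"
  shows "emv_ideal M (state_ker M s)"
  unfolding emv_ideal_def
proof (intro conjI allI impI ballI)
  have "\<zero> \<in> state_ker M s" by (simp add: state_ker_def state_zero[OF s])
  then show "state_ker M s \<noteq> {}" by blast
  show "x \<in> state_ker M s" if "y \<in> state_ker M s \<and> x \<preceq> y" for x y
    using that state_mono[OF s, of x y] state_bounds[OF s, of x]
    by (auto simp: state_ker_def le_carrier)
qed (auto simp: state_ker_def state_plus[OF s])

text \<open>A positive value reaches 1 after finitely many additions. The complement of that
  multiple below any larger idempotent \<open>d\<close> then has value 0, so an ideal containing the
  kernel and \<open>x\<close> contains \<open>d\<close>.\<close>

lemma state_ker_maximal:
  assumes s: "state_morphism M s"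
  shows "emv_maximal_ideal M (state_ker M s)"
  unfolding emv_maximal_ideal_def
proof (intro conjI ballI)
  show "emv_ideal M (state_ker M s)" by (rule state_ker_ideal[OF s])
  obtain u where "u \<in> carrier M" "s u = 1" using s by (auto simp: state_morphism_def)
  then have "u \<in> carrier M" "u \<notin> state_ker M s" by (simp_all add: state_ker_def)
  then show "state_ker M s \<noteq> carrier M" by metis
  fix x assume x: "x \<in> carrier M - state_ker M s"
  then have "s x > 0" using state_bounds[OF s, of x] by (auto simp: state_ker_def)
  then obtain n where "1 < real n * s x" using ex_less_of_nat_mult by blast
  then have n: "s (nmul n x) = 1" using x state_nmul[OF s] by auto
  have "y \<in> J" if y: "y \<in> carrier M" and J: "emv_ideal M J" "insert x (state_ker M s) \<subseteq> J" for y J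
  proof -
    obtain d where d: "d \<in> emv_idem M" "y \<preceq> d" "nmul n x \<preceq> d" "\<zero> \<preceq> d"
      using common_idem[of y "nmul n x" \<zero>] x y by auto
    have "s (emv_lam0 M d (nmul n x)) = 0"
      using state_lam[OF s d(1,3)] state_mono[OF s d(3)] state_bounds[OF s, of d] d n by simp
    then have "emv_lam0 M d (nmul n x) \<in> J" using d J by (auto simp: state_ker_def)
    then have "nmul n x \<boxplus> emv_lam0 M d (nmul n x) \<in> J"
      using J by (intro ideal_plus[OF J(1)] ideal_nmul[OF J(1)]) auto
    then have "d \<in> J" using plus_lam[OF d(1,3)] by simp
    then show ?thesis using ideal_down[OF J(1)] d by blast
  qed
  then have "carrier M \<subseteq> emv_ideal M hull (insert x (state_ker M s))"
    unfolding hull_def by blast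
  moreover have "emv_ideal M hull (insert x (state_ker M s)) \<subseteq> carrier M"
  proof (rule hull_minimal)
    show "insert x (state_ker M s) \<subseteq> carrier M" using x by (auto simp: state_ker_def)
    have "carrier M \<noteq> {}" using zero_closed by blast
    then show "emv_ideal M (carrier M)" by (auto simp: emv_ideal_def dest: le_carrier(1))
  qed
  ultimately show "emv_ideal M hull (insert x (state_ker M s)) = carrier M" by blast
qed

text \<open>Doubling, by \<open>y \<oplus> y\<close> on \<open>[0, 1/2]\<close> and by its dual on \<open>[1/2, 1]\<close>, magnifies any
  difference between two states, while the kernel already determines on which side of
  \<open>1/2\<close> a value lies.\<close>

lemma state_determined_by_ker:
  assumes s: "state_morphism M s" and t: "state_morphism M t"
    and ker: "state_ker M s = state_ker M t" and x: "x \<in> carrier M"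
  shows "s x = t x"
proof -
  have ker_iff: "s y = 0 \<longleftrightarrow> t y = 0" if "y \<in> carrier M" for y
    using ker that by (auto simp: state_ker_def)
  obtain u where u: "u \<in> carrier M" "s u = 1" using s by (auto simp: state_morphism_def)
  \<comment> \<open>\<open>c\<close> is above \<open>x\<close> and above an element of value 1.
    Being idempotent and outside the common kernel, it has value 1 under both states, so complements
    in [0, c] act as 1 minus the value.\<close>
  obtain c where c: "c \<in> emv_idem M" "x \<preceq> c" "u \<preceq> c" using common_idem[OF x u(1) u(1)] .
  have [simp]: "s c = 1" using state_mono[OF s c(3)] u state_bounds[OF s, of c] c by simp
  have [simp]: "t c = 1" using ker_iff[of c] state_idem[OF t c(1)] c by auto
  \<comment> \<open>The claim covers all of [0, c] because the induction step applies it to the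
    doubled elements \<open>d\<close> and \<open>q\<close> in place of \<open>y\<close>.\<close>
  have "\<forall>y. y \<preceq> c \<longrightarrow> \<bar>s y - t y\<bar> \<le> 1 / 2 ^ n" for n
  proof (induction n)
    case 0
    have "\<bar>s y - t y\<bar> \<le> 1" if "y \<preceq> c" for y
      using state_bounds[OF s, of y] state_bounds[OF t, of y] le_carrier(1)[OF that] by auto
    then show ?case by simp
  next
    case (Suc n)
    show ?case
    proof (intro allI impI)
      fix y assume y: "y \<preceq> c"
      then have yc: "y \<in> carrier M" using le_carrier by blast
      define d where "d = y \<boxplus> y"
      define l where "l = emv_lam0 M c y"
      define q where "q = emv_lam0 M c (l \<boxplus> l)"
      have l: "l \<preceq> c" "l \<boxplus> l \<preceq> c" and lc: "l \<in> carrier M"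
        using y c by (auto simp: l_def lam_le idem_plus_le)
      have d: "d \<preceq> c" "d \<in> carrier M" and q: "q \<preceq> c" "q \<in> carrier M"
        using y yc c l by (auto simp: d_def q_def lam_le idem_plus_le)
      have val: "r d = min (2 * r y) 1" "r q = 1 - min (2 - 2 * r y) 1"
        "r (emv_lam0 M c d) = 1 - min (2 * r y) 1" if "state_morphism M r" "r c = 1" for r
      proof -
        show "r d = min (2 * r y) 1" using that yc by (simp add: d_def state_plus)
        then show "r (emv_lam0 M c d) = 1 - min (2 * r y) 1"
          using state_lam[OF that(1) c(1) d(1)] that by simp
        have "r l = 1 - r y" using that y c by (simp add: l_def state_lam)
        then show "r q = 1 - min (2 - 2 * r y) 1"
          using that lc l c by (simp add: q_def state_lam state_plus)
      qed
      have "\<bar>s d - t d\<bar> \<le> 1 / 2 ^ n" "\<bar>s q - t q\<bar> \<le> 1 / 2 ^ n"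
        using Suc d q by auto
      \<comment> \<open>The first kernel condition says that the value of \<open>y\<close> is at
        most 1/2, the second that it is at least 1/2. So one of the two doublings has slope 2 at
        both values.\<close>
      moreover have "s q = 0 \<longleftrightarrow> t q = 0" "s (emv_lam0 M c d) = 0 \<longleftrightarrow> t (emv_lam0 M c d) = 0"
        using ker_iff q d c by auto
      ultimately have "\<bar>2 * s y - 2 * t y\<bar> \<le> 1 / 2 ^ n"
        unfolding val[OF s \<open>s c = 1\<close>] val[OF t \<open>t c = 1\<close>] by (auto simp: min_def split: if_splits)
      moreover have "\<bar>2 * s y - 2 * t y\<bar> = 2 * \<bar>s y - t y\<bar>" by (simp add: abs_if)
      ultimately show "\<bar>s y - t y\<bar> \<le> 1 / 2 ^ Suc n" by simp
    qed
  qed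
  then have "\<bar>s x - t x\<bar> \<le> (1 / 2) ^ n" for n using c by (simp add: power_divide)
  moreover have "(\<lambda>n. (1 / 2) ^ n) \<longlonglongrightarrow> (0::real)" by (rule LIMSEQ_power_zero) simp
  ultimately have "\<bar>s x - t x\<bar> \<le> 0" by (intro LIMSEQ_le_const) auto
  then show ?thesis by simp
qed

text \<open>The terms in the definition of \<open>emv_theta\<close> are the truncated differences in
  [0, b]; such a term has value 0 exactly when \<open>s x \<le> s y\<close>, whichever
  \<open>b\<close> is used.\<close>

lemma theta_state_ker:
  assumes s: "state_morphism M s"
  shows "emv_theta M (state_ker M s) = {(x, y). x \<in> carrier M \<and> y \<in> carrier M \<and> s x = s y}"
proof -
  have le: "emv_lam0 M b (emv_lam0 M b x \<boxplus> y) \<in> state_ker M s \<longleftrightarrow> s x \<le> s y"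
    if b: "b \<in> emv_idem M" and xy: "x \<preceq> b" "y \<preceq> b" for b x y
  proof -
    have lam: "emv_lam0 M b x \<boxplus> y \<preceq> b" using b xy by (simp add: idem_plus_le lam_le)
    have "s x \<le> s b" "s y \<le> s b" "0 \<le> s x" "0 \<le> s y"
      using state_mono[OF s xy(1)] state_mono[OF s xy(2)] state_bounds[OF s, of x]
        state_bounds[OF s, of y] le_carrier(1)[OF xy(1)] le_carrier(1)[OF xy(2)] by auto
    then show ?thesis
      using state_idem[OF s b] lam b xy le_carrier[OF xy(1)] le_carrier[OF xy(2)]
      by (auto simp: state_ker_def state_lam[OF s] state_plus[OF s] min_def)
  qed
  have "(x, y) \<in> emv_theta M (state_ker M s) \<longleftrightarrow> s x = s y"
    if xy: "x \<in> carrier M" "y \<in> carrier M" for x y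
  proof -
    obtain b where "b \<in> emv_idem M" "x \<preceq> b" "y \<preceq> b" "y \<preceq> b"
      using common_idem[OF xy(1,2,2)] .
    then show ?thesis using xy le unfolding emv_theta_def by force
  qed
  then show ?thesis by (auto simp: emv_theta_def)
qed

end

text \<open>\<open>emv_hom\<close> also demands that \<open>N\<close> be an EMV-algebra. The
  injection reduces each axiom to real arithmetic; \<open>unit\<close> provides an idempotent above
  every element, and \<open>compl\<close> the complements.\<close>

lemma emv_hom_of_unit_injection:
  fixes N :: "('a, 'm) emv_scheme" (structure) and f :: "'a \<Rightarrow> real"
  assumes inj: "inj_on f (carrier N)"
    and bounds: "\<And>x. x \<in> carrier N \<Longrightarrow> 0 \<le> f x \<and> f x \<le> 1"
    and join: "\<And>x y. x \<in> carrier N \<Longrightarrow> y \<in> carrier N \<Longrightarrow>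
      x \<curlyvee> y \<in> carrier N \<and> f (x \<curlyvee> y) = max (f x) (f y)"
    and meet: "\<And>x y. x \<in> carrier N \<Longrightarrow> y \<in> carrier N \<Longrightarrow>
      x \<curlywedge> y \<in> carrier N \<and> f (x \<curlywedge> y) = min (f x) (f y)"
    and plus: "\<And>x y. x \<in> carrier N \<Longrightarrow> y \<in> carrier N \<Longrightarrow>
      x \<boxplus> y \<in> carrier N \<and> f (x \<boxplus> y) = min (f x + f y) 1"
    and zero: "\<zero> \<in> carrier N \<and> f \<zero> = 0"
    and unit: "u \<in> carrier N \<and> f u = 1"
    and compl: "\<And>x. x \<in> carrier N \<Longrightarrow> \<exists>y\<in>carrier N. f y = 1 - f x"
  shows "emv_hom N unit_emv f"
proof -
  note [simp] = bounds join meet plus zero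
  have eqI: "x = y" if "f x = f y" "x \<in> carrier N" "y \<in> carrier N" for x y
    using inj that by (auto dest: inj_onD)
  have le: "x \<preceq> y \<longleftrightarrow> x \<in> carrier N \<and> y \<in> carrier N \<and> f x \<le> f y" for x y
  proof (cases "x \<in> carrier N \<and> y \<in> carrier N")
    case True
    then have "x \<curlywedge> y = x \<longleftrightarrow> min (f x) (f y) = f x" using eqI[of "x \<curlywedge> y" x] meet[of x y] by metis
    then show ?thesis using True by (auto simp: emv_le_def)
  qed (auto simp: emv_le_def)
  have idem: "a \<in> emv_idem N \<longleftrightarrow> a \<in> carrier N \<and> (f a = 0 \<or> f a = 1)" for a
  proof (cases "a \<in> carrier N")
    case True
    then have "a \<boxplus> a = a \<longleftrightarrow> min (f a + f a) 1 = f a" using eqI[of "a \<boxplus> a" a] plus[of a a] by metis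
    then show ?thesis using True by (auto simp: emv_idem_def min_def)
  qed (auto simp: emv_idem_def)
  have interval: "x \<in> emv_interval N a b \<longleftrightarrow> x \<in> carrier N \<and> f a \<le> f x \<and> f x \<le> f b"
    if "a \<in> carrier N" "b \<in> carrier N" for a b x
    using that by (auto simp: emv_interval_def le)
  \<comment> \<open>One formula for both kinds of interval: between the values 0 and 1 it gives
    \<open>1 - f x\<close>; in a one-point interval it gives \<open>f x\<close>, so that
    \<open>x\<close> is its own complement.\<close>
  have lam: "\<exists>z\<in>carrier N. f z = f a + f b - f x \<and> emv_is_min N (emv_complements N a b x) z
      \<and> emv_lam N a b x = z"
    if a: "a \<in> emv_idem N" and b: "b \<in> emv_idem N" and ab: "a \<preceq> b" and x: "x \<in> emv_interval N a b"
    for a b x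
  proof -
    have c [simp]: "a \<in> carrier N" "b \<in> carrier N" "x \<in> carrier N"
      using ab x by (auto simp: le emv_interval_def)
    have cases: "f a = 0 \<and> f b = 1 \<or> f a = f b \<and> f x = f a \<and> (f a = 0 \<or> f a = 1)"
    proof -
      have "f a \<le> f x" "f x \<le> f b" using x by (auto simp: interval)
      moreover have "f a = 0 \<or> f a = 1" "f b = 0 \<or> f b = 1" using a b by (auto simp: idem)
      ultimately show ?thesis by (smt (verit))
    qed
    have "f a + f b - f x = 1 - f x \<or> f a + f b - f x = f x" using cases by linarith
    then have "\<exists>z\<in>carrier N. f z = f a + f b - f x" using compl[OF c(3)] c(3) by metis
    then obtain z where z: "z \<in> carrier N" "f z = f a + f b - f x" by blast
    have compl_iff: "w \<in> emv_complements N a b x \<longleftrightarrow> w \<in> carrier N \<and> f a + f b - f x \<le> f w \<and> f w \<le> f b"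
      for w
    proof (cases "w \<in> carrier N")
      case True
      then have "x \<boxplus> w = b \<longleftrightarrow> min (f x + f w) 1 = f b" using eqI[of "x \<boxplus> w" b] plus[of x w] c by metis
      moreover have "f a \<le> f w \<and> f w \<le> f b \<and> min (f x + f w) 1 = f b
          \<longleftrightarrow> f a + f b - f x \<le> f w \<and> f w \<le> f b"
        using cases bounds[OF True] bounds[OF c(3)] by (smt (verit))
      ultimately show ?thesis using True by (auto simp: emv_complements_def interval)
    qed (auto simp: emv_complements_def interval)
    have min: "emv_is_min N (emv_complements N a b x) z"
      using z x by (auto simp: emv_is_min_def compl_iff le interval)
    moreover have "emv_lam N a b x = z"
      unfolding emv_lam_def
    proof (rule the_equality[where P = "emv_is_min N (emv_complements N a b x)", OF min])
      fix w assume "emv_is_min N (emv_complements N a b x) w"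
      with min have "z \<preceq> w" "w \<preceq> z" by (simp_all add: emv_is_min_def)
      then show "w = z" unfolding le by (intro eqI order_antisym) simp_all
    qed
    ultimately show ?thesis using z by blast
  qed
  have lam_val: "emv_lam N a b x \<in> carrier N" "f (emv_lam N a b x) = f a + f b - f x"
    if "a \<in> emv_idem N" "b \<in> emv_idem N" "a \<preceq> b" "x \<in> emv_interval N a b" for a b x
    using lam[OF that] by auto
  have assoc: "x \<boxplus> y \<boxplus> z = x \<boxplus> (y \<boxplus> z)"
    if xyz: "x \<in> carrier N" "y \<in> carrier N" "z \<in> carrier N" for x y z
  proof (rule eqI)
    show "f (x \<boxplus> y \<boxplus> z) = f (x \<boxplus> (y \<boxplus> z))"
      using bounds[OF xyz(1)] bounds[OF xyz(2)] bounds[OF xyz(3)] xyz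
      by (simp add: min_def del: bounds) (smt (verit) bounds)
  qed (use xyz in simp_all)
  have comm: "x \<boxplus> y = y \<boxplus> x" if "x \<in> carrier N" "y \<in> carrier N" for x y
    using that by (intro eqI) (simp_all add: add.commute)
  interpret N: emv_algebra N
  proof (intro emv_algebra.intro)
    show "comm_monoid \<lparr>carrier = carrier N, mult = (\<boxplus>), one = \<zero>\<rparr>"
      by (rule comm_monoidI) (auto intro: eqI assoc comm)
    fix a b assume ab: "a \<in> emv_idem N" "b \<in> emv_idem N" "a \<preceq> b"
    note lv = lam_val[OF ab]
    have c [simp]: "a \<in> carrier N" "b \<in> carrier N" using ab by (auto simp: le)
    have cases: "f a = 0 \<and> f b = 1 \<or> f a = 0 \<and> f b = 0 \<or> f a = 1 \<and> f b = 1"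
      using ab by (auto simp: idem le)
    show "\<exists>z. emv_is_min N (emv_complements N a b x) z" if "x \<in> emv_interval N a b" for x
      using lam[OF ab that] by blast
    have ends: "a \<boxplus> x = x" "x \<boxplus> b = b" if x: "x \<in> emv_interval N a b" for x
    proof -
      have xc: "x \<in> carrier N" "f a \<le> f x" "f x \<le> f b" using x by (auto simp: interval)
      have "min (f a + f x) 1 = f x" "min (f x + f b) 1 = f b"
        using cases xc(2,3) bounds[OF xc(1)] by (smt (verit))+
      then show "a \<boxplus> x = x" "x \<boxplus> b = b" using xc by (auto intro: eqI)
    qed
    have plus_in: "x \<boxplus> y \<in> emv_interval N a b"
      if xy: "x \<in> emv_interval N a b" "y \<in> emv_interval N a b" for x y
    proof -
      have c: "x \<in> carrier N" "y \<in> carrier N" and le: "f a \<le> f x" "f x \<le> f b" "f a \<le> f y" "f y \<le> f b"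
        using xy by (auto simp: interval)
      have "f a \<le> min (f x + f y) 1" "min (f x + f y) 1 \<le> f b"
        using cases le bounds[OF c(1)] bounds[OF c(2)] by (smt (verit))+
      then show ?thesis using c by (simp add: interval)
    qed
    have ai: "a \<in> emv_interval N a b" using ab by (simp add: interval le)
    have in_carrier: "x \<in> carrier N" if "x \<in> emv_interval N a b" for x
      using that by (simp add: interval)
    show "mv_algebra (emv_interval N a b) (\<boxplus>) (emv_lam N a b) a b"
    proof (rule mv_algebra.intro)
      show "comm_monoid \<lparr>carrier = emv_interval N a b, mult = (\<boxplus>), one = a\<rparr>"
        using ai by (intro comm_monoidI) (auto intro: plus_in assoc comm ends(1) in_carrier)
      show "b \<in> emv_interval N a b" using ab by (simp add: interval le)
      show "emv_lam N a b a = b" using lv[OF ai] by (intro eqI) auto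
      fix x assume x: "x \<in> emv_interval N a b"
      have xc: "x \<in> carrier N" "f a \<le> f x" "f x \<le> f b" using x by (auto simp: interval)
      have nxI: "emv_lam N a b w \<in> emv_interval N a b" if "w \<in> emv_interval N a b" for w
        using lv[OF that] that by (simp add: interval)
      show nx: "emv_lam N a b x \<in> emv_interval N a b" by (rule nxI[OF x])
      show "emv_lam N a b (emv_lam N a b x) = x" using lv[OF nx] lv[OF x] xc by (intro eqI) auto
      show "x \<boxplus> b = b" by (rule ends(2)[OF x])
      fix y assume y: "y \<in> emv_interval N a b"
      \<comment> \<open>Each side of the Lukasiewicz axiom has the maximum as its value, and this is
        symmetric.\<close>
      have luk: "v \<boxplus> emv_lam N a b (v \<boxplus> emv_lam N a b w) \<in> carrier N \<and>
          f (v \<boxplus> emv_lam N a b (v \<boxplus> emv_lam N a b w)) = max (f v) (f w)"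
        if v: "v \<in> emv_interval N a b" and w: "w \<in> emv_interval N a b" for v w
      proof -
        have vc: "v \<in> carrier N" "f a \<le> f v" "f v \<le> f b" and wc: "w \<in> carrier N" "f a \<le> f w" "f w \<le> f b"
          using v w by (auto simp: interval)
        have i: "v \<boxplus> emv_lam N a b w \<in> emv_interval N a b"
          using nxI[OF w] v by (intro plus_in)
        have "min (f v + (f a + f b - min (f v + (f a + f b - f w)) 1)) 1 = max (f v) (f w)"
          using cases vc(2,3) wc(2,3) bounds[OF vc(1)] bounds[OF wc(1)] by (smt (verit))
        then show ?thesis using lv[OF i] lv[OF w] vc by simp
      qed
      show "x \<boxplus> emv_lam N a b (x \<boxplus> emv_lam N a b y) = y \<boxplus> emv_lam N a b (y \<boxplus> emv_lam N a b x)"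
        using luk[OF x y] luk[OF y x] by (intro eqI) (auto simp: max.commute)
    qed
  next
    fix x y z assume "x \<preceq> y" "z \<in> carrier N"
    then show "x \<boxplus> z \<preceq> y \<boxplus> z" by (auto simp: le)
  next
    fix x assume "x \<in> carrier N"
    then show "\<exists>a\<in>emv_idem N. x \<preceq> a" using unit by (intro bexI[of _ u]) (auto simp: idem le)
  qed (auto intro!: eqI simp: le min_def max_def)
  show ?thesis
    unfolding N.emv_hom_unit_iff
    using lam_val[of \<zero>] by (auto simp: idem le interval)
qed

section \<open>Embedding the quotient by a maximal ideal\<close>

context emv_algebra
begin

lemma quotient_embedding:
  assumes s: "state_morphism M s"
  defines "Q \<equiv> emv_quot M (state_ker M s)"
  shows "\<exists>f. emv_embedding Q unit_emv f \<and> f \<in> extensional (carrier Q) \<and>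
    (\<forall>x\<in>carrier M. f (emv_class M (state_ker M s) x) = s x)"
proof -
  let ?c = "emv_class M (state_ker M s)"
  have cls: "?c x = {y \<in> carrier M. s y = s x}" if "x \<in> carrier M" for x
    using that by (auto simp: theta_state_ker[OF s])
  have Q: "carrier Q = ?c ` carrier M"
    by (auto simp: Q_def emv_quot_def quotient_def)
  have c_eq: "?c x = ?c y \<longleftrightarrow> s x = s y" if "x \<in> carrier M" "y \<in> carrier M" for x y
    using that by (auto simp: cls)
  \<comment> \<open>The value of \<open>g x' y'\<close> depends only on the values of its arguments,
    so all classes in the union coincide.\<close>
  have union: "(\<Union>x'\<in>?c x. \<Union>y'\<in>?c y. ?c (g x' y')) = ?c (g x y)"
    if "x \<in> carrier M" "y \<in> carrier M" "\<And>x y. x \<in> carrier M \<Longrightarrow> y \<in> carrier M \<Longrightarrow> g x y \<in> carrier M"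
      "\<And>x y. x \<in> carrier M \<Longrightarrow> y \<in> carrier M \<Longrightarrow> s (g x y) = h (s x) (s y)" for x y g h
    using that by (auto simp: cls)
  have join: "?c x \<curlyvee>\<^bsub>Q\<^esub> ?c y = ?c (x \<curlyvee> y)"
    and meet: "?c x \<curlywedge>\<^bsub>Q\<^esub> ?c y = ?c (x \<curlywedge> y)"
    and plus: "?c x \<boxplus>\<^bsub>Q\<^esub> ?c y = ?c (x \<boxplus> y)" if "x \<in> carrier M" "y \<in> carrier M" for x y
    using union[OF that, of "(\<curlyvee>)" max] union[OF that, of "(\<curlywedge>)" min]
      union[OF that, of "(\<boxplus>)" "\<lambda>p q. min (p + q) 1"]
    by (simp_all add: Q_def emv_quot_def state_join[OF s] state_meet[OF s] state_plus[OF s])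
  have zero: "\<zero>\<^bsub>Q\<^esub> = ?c \<zero>" by (simp add: Q_def emv_quot_def)
  define f where "f = restrict (\<lambda>X. s (SOME x. x \<in> X)) (carrier Q)"
  have f: "f (?c x) = s x" if "x \<in> carrier M" for x
    using that someI[of "\<lambda>y. y \<in> ?c x" x] by (auto simp: f_def Q cls)
  obtain u where u: "u \<in> carrier M" "s u = 1" using s by (auto simp: state_morphism_def)
  have inj: "inj_on f (carrier Q)" by (auto simp: inj_on_def Q f c_eq)
  have "emv_hom Q unit_emv f"
  proof (rule emv_hom_of_unit_injection[OF inj, of "?c u"])
    fix X assume "X \<in> carrier Q"
    then obtain x where x: "x \<in> carrier M" "X = ?c x" by (auto simp: Q)
    show "0 \<le> f X \<and> f X \<le> 1" using x state_bounds[OF s] by (simp add: f)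
    \<comment> \<open>The quotient needs complements relative to its top; an idempotent above
      \<open>u\<close> represents that top, since it has value 1.\<close>
    obtain d where d: "d \<in> emv_idem M" "x \<preceq> d" "u \<preceq> d" using common_idem[OF x(1) u(1) u(1)] .
    have "s d = 1" using state_mono[OF s d(3)] u state_bounds[OF s, of d] d by simp
    then have "f (?c (emv_lam0 M d x)) = 1 - f X" using d x by (simp add: f state_lam[OF s])
    then show "\<exists>Y\<in>carrier Q. f Y = 1 - f X" using d by (auto simp: Q)
    fix Y assume "Y \<in> carrier Q"
    then obtain y where y: "y \<in> carrier M" "Y = ?c y" by (auto simp: Q)
    show "X \<curlyvee>\<^bsub>Q\<^esub> Y \<in> carrier Q \<and> f (X \<curlyvee>\<^bsub>Q\<^esub> Y) = max (f X) (f Y)"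
      "X \<curlywedge>\<^bsub>Q\<^esub> Y \<in> carrier Q \<and> f (X \<curlywedge>\<^bsub>Q\<^esub> Y) = min (f X) (f Y)"
      "X \<boxplus>\<^bsub>Q\<^esub> Y \<in> carrier Q \<and> f (X \<boxplus>\<^bsub>Q\<^esub> Y) = min (f X + f Y) 1"
      using x y by (auto simp: join meet plus f state_join[OF s] state_meet[OF s] state_plus[OF s] Q)
  qed (use u in \<open>auto simp: zero f state_zero[OF s] Q\<close>)
  then show ?thesis
    using inj f by (intro exI[of _ f]) (auto simp: emv_embedding_def f_def)
qed

text \<open>Injectivity leaves only the class of \<open>\<zero>\<close> in the kernel; a
  state-morphism with kernel \<open>I\<close> serves to identify that class with
  \<open>I\<close>.\<close>

lemma quot_embedding_ker:
  assumes I: "emv_maximal_ideal M I" and f: "quot_embedding M I f"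
  shows "state_ker M (\<lambda>x. f (emv_class M I x)) = I"
proof -
  obtain s where s: "state_morphism M s" "state_ker M s = I"
    by (rule maximal_ideal_state_morphism[OF I])
  let ?c = "emv_class M I"
  have theta: "emv_theta M I = {(x, y). x \<in> carrier M \<and> y \<in> carrier M \<and> s x = s y}"
    using theta_state_ker[OF s(1)] s(2) by simp
  have "f (?c \<zero>) = 0" and inj: "inj_on f (carrier (emv_quot M I))"
    using f by (auto simp: quot_embedding_def emv_embedding_def emv_hom_def emv_quot_def)
  moreover have "?c x \<in> carrier (emv_quot M I)" if "x \<in> carrier M" for x
    using that by (simp add: emv_quot_def quotientI)
  ultimately have "f (?c x) = 0 \<longleftrightarrow> ?c x = ?c \<zero>" if "x \<in> carrier M" for x
    using that inj_on_eq_iff[OF inj, of "?c x" "?c \<zero>"] by simp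
  moreover have "?c x = ?c \<zero> \<longleftrightarrow> s x = 0" if "x \<in> carrier M" for x
    using that state_zero[OF s(1)] by (auto simp: theta)
  ultimately show ?thesis using s(2) by (auto simp: state_ker_def)
qed

text \<open>Two candidates induce state-morphisms with the same kernel \<open>I\<close>, hence agree
  on every class; extensionality settles the remaining arguments.\<close>

lemma ex1_quot_embedding:
  assumes I: "emv_maximal_ideal M I"
  shows "\<exists>!f. quot_embedding M I f"
proof -
  obtain s where s: "state_morphism M s" "state_ker M s = I"
    by (rule maximal_ideal_state_morphism[OF I])
  let ?c = "emv_class M I"
  obtain f where f: "emv_embedding (emv_quot M I) unit_emv f"
    "f \<in> extensional (carrier (emv_quot M I))" "\<And>x. x \<in> carrier M \<Longrightarrow> f (?c x) = s x"
    using quotient_embedding[OF s(1)] unfolding s(2) by blast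
  have "state_morphism M (\<lambda>x. f (?c x))"
    using s(1) by (subst state_morphism_cong[OF f(3)])
  then have "quot_embedding M I f" using f(1,2) by (simp add: quot_embedding_def)
  moreover have "g = h" if g: "quot_embedding M I g" and h: "quot_embedding M I h" for g h
  proof (rule extensionalityI)
    show "g \<in> extensional (carrier (emv_quot M I))" "h \<in> extensional (carrier (emv_quot M I))"
      using g h by (simp_all add: quot_embedding_def)
    fix X assume "X \<in> carrier (emv_quot M I)"
    then obtain x where x: "x \<in> carrier M" "X = ?c x" by (auto simp: emv_quot_def quotient_def)
    have "state_morphism M (\<lambda>x. g (?c x))" "state_morphism M (\<lambda>x. h (?c x))"
      using g h by (simp_all add: quot_embedding_def)
    moreover have "state_ker M (\<lambda>x. g (?c x)) = state_ker M (\<lambda>x. h (?c x))"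
      unfolding quot_embedding_ker[OF I g] quot_embedding_ker[OF I h] ..
    ultimately have "g (?c x) = h (?c x)" using x(1) by (rule state_determined_by_ker)
    then show "g X = h X" using x by simp
  qed
  ultimately show ?thesis by blast
qed

lemma ideal_state:
  assumes I: "emv_maximal_ideal M I"
  shows "state_morphism M (ideal_state M I)" "state_ker M (ideal_state M I) = I"
proof -
  have eq: "ideal_state M I = (\<lambda>x. (THE f. quot_embedding M I f) (emv_class M I x))"
    by (simp add: ideal_state_def fun_eq_iff)
  have q: "quot_embedding M I (THE f. quot_embedding M I f)"
    by (rule theI'[OF ex1_quot_embedding[OF I]])
  then show "state_morphism M (ideal_state M I)" by (simp add: quot_embedding_def eq)
  show "state_ker M (ideal_state M I) = I" using quot_embedding_ker[OF I q] by (simp add: eq)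
qed

end

theorem theorem4p2:
  fixes M :: "('a, 'm) emv_scheme"
  assumes "emv_algebra M"
  shows
    "(\<forall>I. emv_maximal_ideal M I \<longrightarrow> (\<exists>!f. quot_embedding M I f)) \<and>
     (\<forall>s. state_morphism M s \<longrightarrow>
        emv_maximal_ideal M (state_ker M s) \<and>
        (\<exists>!I. emv_maximal_ideal M I \<and> (\<forall>x\<in>carrier M. s x = ideal_state M I x))) \<and>
     (\<forall>s\<^sub>1 s\<^sub>2. state_morphism M s\<^sub>1 \<and> state_morphism M s\<^sub>2 \<and>
        state_ker M s\<^sub>1 = state_ker M s\<^sub>2 \<longrightarrow>
        (\<forall>x\<in>carrier M. s\<^sub>1 x = s\<^sub>2 x))"
proof -
  interpret emv_algebra M by fact
  have unique: "\<exists>!I. emv_maximal_ideal M I \<and> (\<forall>x\<in>carrier M. s x = ideal_state M I x)"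
    if s: "state_morphism M s" for s
  proof (rule ex1I[of _ "state_ker M s"])
    have max: "emv_maximal_ideal M (state_ker M s)" by (rule state_ker_maximal[OF s])
    have "s x = ideal_state M (state_ker M s) x" if "x \<in> carrier M" for x
      by (rule state_determined_by_ker[OF s ideal_state(1)[OF max] _ that])
         (simp add: ideal_state(2)[OF max])
    with max show "emv_maximal_ideal M (state_ker M s) \<and>
        (\<forall>x\<in>carrier M. s x = ideal_state M (state_ker M s) x)"
      by blast
    \<comment> \<open>Taking the kernel recovers \<open>I\<close> from
      \<open>ideal_state M I\<close>, so no other ideal can represent \<open>s\<close>.\<close>
    fix I assume I: "emv_maximal_ideal M I \<and> (\<forall>x\<in>carrier M. s x = ideal_state M I x)"
    then have "state_ker M s = state_ker M (ideal_state M I)" unfolding state_ker_def by auto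
    then show "I = state_ker M s" using I ideal_state(2)[of I] by simp
  qed
  show ?thesis
  proof (intro conjI allI impI ballI)
    show "\<exists>!f. quot_embedding M I f" if "emv_maximal_ideal M I" for I
      by (rule ex1_quot_embedding[OF that])
    show "emv_maximal_ideal M (state_ker M s)" if "state_morphism M s" for s
      by (rule state_ker_maximal[OF that])
    show "\<exists>!I. emv_maximal_ideal M I \<and> (\<forall>x\<in>carrier M. s x = ideal_state M I x)"
      if "state_morphism M s" for s
      by (rule unique[OF that])
    show "s\<^sub>1 x = s\<^sub>2 x" if "state_morphism M s\<^sub>1 \<and> state_morphism M s\<^sub>2 \<and>
        state_ker M s\<^sub>1 = state_ker M s\<^sub>2" "x \<in> carrier M" for s\<^sub>1 s\<^sub>2 x
      using that by (auto intro: state_determined_by_ker)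
  qed
qed

end
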